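(* Let $M\in\mathbb{R}^{n\times n}$ be positive semidefinite with $\mathcal{F}^+\ne\emptyset$, and assume that the LCP has a unique solution $(\mathbf{x}^*,\mathbf{s}^* )$ and that this solution is strictly complementary. Let $\beta\in(0,\frac13)$, $\tau=\omega_*\!\left(\frac{2\beta}{1-\beta}\right)$, $\mathbf{z}^{(0)}\in\mathcal{N}_\delta(\beta)$, and let $v_0^{(k)}$ be the first coordinate of the vector $\mathbf{w}$ in the $k$-th iteration of the AC IPA started at $\mathbf{z}^{(0)}$ (i.e. after $k$ passes through its outer loop). If $v_0^{(0)}\le\frac{\sigma^2}{4\kappa}$, then for every $k\ge1$ for which the $(k+1)$-st iteration is performed, $$v_0^{(k+1)}\le\left(\frac{12(1-\beta)(n+1)}{\beta\left(v_0^{(0)}-v_0^{(k)}\right)}+\frac{2\beta}{(1-\beta)\,v_0^{(0)}(n+1)}\right)\left(v_0^{(k)}\right)^2 .$$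
   Context: Setting. $n\ge 1$, $M\in\mathbb{R}^{n\times n}$ is positive semidefinite ($\mathbf{x}^TM\mathbf{x}\ge0$ for all $\mathbf{x}$; not necessarily symmetric), $\mathbf{q}\in\mathbb{R}^n$. The LCP is: find $\mathbf{x},\mathbf{s}\ge 0$ with $-M\mathbf{x}+\mathbf{s}=\mathbf{q}$, $\mathbf{x}\mathbf{s}=\mathbf{0}$. All operations on vectors (products, squares, quotients, roots) are componentwise; $\|\cdot\|$ is the Euclidean norm; $\mathbf{e}\in\mathbb{R}^n$ and $\bar{\mathbf{e}}\in\mathbb{R}^{n+1}$ are all-ones vectors. $\mathcal{F}=\{(\mathbf{x},\mathbf{s}): \mathbf{x},\mathbf{s}\ge0,\ -M\mathbf{x}+\mathbf{s}=\mathbf{q}\}$, $\mathcal{F}^+=\{(\mathbf{x},\mathbf{s})\in\mathcal{F}:\mathbf{x},\mathbf{s}>0\}$. Constants of the problem. Strict complementarity means $\mathbf{x}^*+\mathbf{s}^*>0$. Put $B=\{i:x_i^*>0\}$, $N=\{i:s_i^*>0\}$ (a partition of $\{1,\dots,n\}$), and write vectors and matrices in blocks accordingly. Uniqueness of the solution implies that $M_{BB}$ is invertible. Let $$\hat M=\begin{pmatrix}M_{BB}^{-1}&-M_{BB}^{-1}M_{BN}\\ M_{NB}M_{BB}^{-1}&M_{NN}-M_{NB}M_{BB}^{-1}M_{BN}\end{pmatrix},$$ $\kappa=\|\hat M\|_\infty$ (matrix norm induced by the vector $\infty$-norm, i.e. maximum absolute row sum), $\sigma=\min\{\min_{i\in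 B}x_i^*,\min_{i\in N}s_i^*\}$. If $\kappa=0$, then $\sigma^2/(4\kappa)$ is read as $+\infty$. Parabolic target space. For $\mathbf{w}=(v_0,\mathbf{v})\in\mathbb{R}\times\mathbb{R}^n$: $\mathcal{F}_w^+=\{\mathbf{w}: v_0>\|\mathbf{v}\|^2\}$, $\rho(\mathbf{w})=\frac{v_0-\|\mathbf{v}\|^2}{n+1}$. $\mathcal{F}_z^+=\{\mathbf{z}=(\mathbf{x},\mathbf{s},\mathbf{w}):(\mathbf{x},\mathbf{s})\in\mathcal{F}^+,\ \mathbf{w}\in\mathcal{F}_w^+,\ \mathbf{x}\mathbf{s}>\mathbf{v}^2,\ \mathbf{x}^T\mathbf{s}<v_0\}$. For $\mathbf{z}\in\mathcal{F}_z^+$: $r_0(\mathbf{z})=v_0-\mathbf{x}^T\mathbf{s}$, $r_i(\mathbf{z})=x_is_i-v_i^2$ ($1\le i\le n$), $\hat{\mathbf{r}}(\mathbf{z})=\sqrt{\mathbf{r}(\mathbf{z})/\rho(\mathbf{w})}\in\mathbb{R}^{n+1}$, $F(\mathbf{z})=-\sum_{i=0}^n\ln r_i(\mathbf{z})$, $\Psi(\mathbf{z})=-\sum_{i=0}^n\ln \hat r_i^2(\mathbf{z})$, $\zeta_0(\mathbf{z})=\|\hat{\mathbf{r}}(\mathbf{z})-1/\hat{\mathbf{r}}(\mathbf{z})\|$, $\zeta_1(\mathbf{z})=\|1/\hat{\mathbf{r}}^2(\mathbf{z})-\bar{\mathbf{e}}\|$, $\delta(\mathbf{z})=\zeta_0^2(\mathbf{z})/\zeta_1(\mathbf{z})$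 (and $\delta(\mathbf{z})=0$ if $\zeta_1(\mathbf{z})=0$). $\mathcal{N}_\delta(\beta)=\{\mathbf{z}\in\mathcal{F}_z^+:\delta(\mathbf{z})\le\beta\}$, $\mathcal{N}_\Psi(\tau)=\{\mathbf{z}\in\mathcal{F}_z^+:\Psi(\mathbf{z})\le\tau\}$. $\omega_*(t)=-t-\ln(1-t)$ for $t\in[0,1)$. Directions: given $\mathbf{z}\in\mathcal{F}_z^+$ and $\mathbf{a}\in\mathbb{R}^n$, $(\Delta\mathbf{x},\Delta\mathbf{s})$ is the unique solution of $-M\Delta\mathbf{x}+\Delta\mathbf{s}=\mathbf{0}$, $\mathbf{s}\Delta\mathbf{x}+\mathbf{x}\Delta\mathbf{s}=\mathbf{a}$. Right-hand sides: corrector $\mathbf{a}_c(\mathbf{z})=\rho(\mathbf{w})\mathbf{e}-\mathbf{x}\mathbf{s}+\mathbf{v}^2$; auto-corrector $\mathbf{a}_{ac}(\mathbf{z})=\frac{\|\mathbf{v}\|^2}{n+1}\mathbf{e}-\mathbf{v}^2-\mathbf{x}\mathbf{s}$. Algorithm (AC IPA) with parameters $\varepsilon>0$, $\beta$, $\tau$ and starting point $\mathbf{z}^{(0)}=(\mathbf{x}^{(0)},\mathbf{s}^{(0)},\mathbf{w}^{(0)})\in\mathcal{N}_\delta(\beta)$, $\mathbf{w}^{(0)}=(v_0^{(0)},\mathbf{v}^{(0)})$. Set $\mathbf{z}=(\mathbf{x},\mathbf{s},\mathbf{w}):=\mathbf{z}^{(0)}$. While $v_0>\varepsilon$ (outer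 loop): (Predictor) compute $(\Delta\mathbf{x},\Delta\mathbf{s})$ with $\mathbf{a}=\mathbf{a}_{ac}(\mathbf{z})$; let $\alpha_p=\max\{\alpha\in[0,1]:(\mathbf{x}+\alpha\Delta\mathbf{x},\mathbf{s}+\alpha\Delta\mathbf{s},(1-\alpha)\mathbf{w})\in\mathcal{N}_\Psi(\tau)\}$; replace $\mathbf{z}$ by $(\mathbf{x}+\alpha_p\Delta\mathbf{x},\mathbf{s}+\alpha_p\Delta\mathbf{s},(1-\alpha_p)\mathbf{w})$. (Correctors) while $\mathbf{z}\notin\mathcal{N}_\delta(\beta)$: compute $(\Delta\mathbf{x},\Delta\mathbf{s})$ with $\mathbf{a}=\mathbf{a}_c(\mathbf{z})$; let $\alpha_c$ minimize $F(\mathbf{x}+\alpha\Delta\mathbf{x},\mathbf{s}+\alpha\Delta\mathbf{s},\mathbf{w})$ over those $\alpha\in[0,1]$ for which the argument lies in $\mathcal{F}_z^+$; replace $(\mathbf{x},\mathbf{s})$ by $(\mathbf{x}+\alpha_c\Delta\mathbf{x},\mathbf{s}+\alpha_c\Delta\mathbf{s})$, keeping $\mathbf{w}$. A run of the algorithm presupposes that the maximum defining $\alpha_p$ is attained in each predictor step performed. *)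

theory Defs
  imports "HOL-Analysis.Analysis"
begin

text \<open>
  The coordinates of a vector in dimension n are indexed by a finite type \<open>'n\<close>, so
  n = \<open>CARD('n)\<close>. Vectors of dimension n + 1 are indexed by \<open>'n option\<close>, where \<open>None\<close> is
  coordinate 0 and \<open>Some i\<close> is coordinate i. A product \<open>x * s\<close> of vectors is the
  componentwise one.
\<close>

definition psd :: "real^'n^'n \<Rightarrow> bool" where
  "psd M \<longleftrightarrow> (\<forall>x. x \<bullet> (M *v x) \<ge> 0)"

definition lcp_feasible :: "real^'n^'n \<Rightarrow> real^'n \<Rightarrow> ((real^'n) \<times> (real^'n)) set" where
  "lcp_feasible M q =
     {(x, s). (\<forall>i. x $ i \<ge> 0) \<and> (\<forall>i. s $ i \<ge> 0) \<and> - (M *v x) + s = q}"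

definition lcp_interior :: "real^'n^'n \<Rightarrow> real^'n \<Rightarrow> ((real^'n) \<times> (real^'n)) set" where
  "lcp_interior M q =
     {(x, s) \<in> lcp_feasible M q. (\<forall>i. x $ i > 0) \<and> (\<forall>i. s $ i > 0)}"

definition lcp_solutions :: "real^'n^'n \<Rightarrow> real^'n \<Rightarrow> ((real^'n) \<times> (real^'n)) set" where
  "lcp_solutions M q = {(x, s) \<in> lcp_feasible M q. x * s = 0}"

text \<open>
  Blocks are kept inside n by n matrices, padded with zeros outside \<open>I \<times> J\<close>. Then \<open>**\<close>
  multiplies compatible blocks, and a block matrix is the sum of its (padded) blocks.
\<close>

definition block :: "real^'n^'n \<Rightarrow> 'n set \<Rightarrow> 'n set \<Rightarrow> real^'n^'n" where
  "block A I J = (\<chi> i j. if i \<in> I \<and> j \<in> J then A $ i $ j else 0)"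

text \<open>The inverse of the square block \<open>A\<^sub>B\<^sub>B\<close>, again padded; \<open>block (mat 1) B B\<close> is the
  identity matrix on the index set \<open>B\<close>.\<close>

definition block_inv :: "real^'n^'n \<Rightarrow> 'n set \<Rightarrow> real^'n^'n" where
  "block_inv A B = (THE G. block G B B = G
      \<and> block A B B ** G = block (mat 1) B B \<and> G ** block A B B = block (mat 1) B B)"

definition M_hat :: "real^'n^'n \<Rightarrow> 'n set \<Rightarrow> 'n set \<Rightarrow> real^'n^'n" where
  "M_hat M B N =
     block_inv M B
     + (- (block_inv M B ** block M B N))
     + block M N B ** block_inv M B
     + (block M N N - block M N B ** block_inv M B ** block M B N)"

definition row_sum_norm :: "real^'n^'m \<Rightarrow> real" where
  "row_sum_norm A = Max (range (\<lambda>i. \<Sum>j\<in>UNIV. \<bar>A $ i $ j\<bar>))"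

text \<open>In the next two definitions \<open>(x, s)\<close> is the solution of the LCP, which gives
  the sets B and N.\<close>

definition lcp_kappa :: "real^'n^'n \<Rightarrow> real^'n \<Rightarrow> real^'n \<Rightarrow> real" where
  "lcp_kappa M x s = row_sum_norm (M_hat M {i. x $ i > 0} {i. s $ i > 0})"

definition lcp_sigma :: "real^'n \<Rightarrow> real^'n \<Rightarrow> real" where
  "lcp_sigma x s = Min ((($) x) ` {i. x $ i > 0} \<union> (($) s) ` {i. s $ i > 0})"

text \<open>\<open>w = (v\<^sub>0, v)\<close> and \<open>z = (x, s, w)\<close>.\<close>

type_synonym 'n wpoint = "real \<times> (real^'n)"
type_synonym 'n zpoint = "(real^'n) \<times> (real^'n) \<times> 'n wpoint"

definition w_interior :: "('n::finite) wpoint set" where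
  "w_interior = {(v0, v). v0 > (norm v)\<^sup>2}"

fun rho :: "('n::finite) wpoint \<Rightarrow> real" where
  "rho (v0, v) = (v0 - (norm v)\<^sup>2) / (real CARD('n) + 1)"

definition z_interior :: "real^'n^'n \<Rightarrow> real^'n \<Rightarrow> ('n::finite) zpoint set" where
  "z_interior M q = {(x, s, (v0, v)). (x, s) \<in> lcp_interior M q \<and> (v0, v) \<in> w_interior
      \<and> (\<forall>i. x $ i * s $ i > (v $ i)\<^sup>2) \<and> x \<bullet> s < v0}"

fun v0_coord :: "('n::finite) zpoint \<Rightarrow> real" where
  "v0_coord (x, s, (v0, v)) = v0"

fun resid :: "('n::finite) zpoint \<Rightarrow> real^('n option)" where
  "resid (x, s, (v0, v)) =
     (\<chi> i. case i of None \<Rightarrow> v0 - x \<bullet> s | Some j \<Rightarrow> x $ j * s $ j - (v $ j)\<^sup>2)"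

fun resid_hat :: "('n::finite) zpoint \<Rightarrow> real^('n option)" where
  "resid_hat (x, s, w) = (\<chi> i. sqrt (resid (x, s, w) $ i / rho w))"

definition barrier_F :: "('n::finite) zpoint \<Rightarrow> real" where
  "barrier_F z = - (\<Sum>i\<in>UNIV. ln (resid z $ i))"

definition Psi :: "('n::finite) zpoint \<Rightarrow> real" where
  "Psi z = - (\<Sum>i\<in>UNIV. ln ((resid_hat z $ i)\<^sup>2))"

definition zeta0 :: "('n::finite) zpoint \<Rightarrow> real" where
  "zeta0 z = norm (\<chi> i. resid_hat z $ i - 1 / resid_hat z $ i)"

definition zeta1 :: "('n::finite) zpoint \<Rightarrow> real" where
  "zeta1 z = norm (\<chi> i. 1 / (resid_hat z $ i)\<^sup>2 - 1)"

definition delta :: "('n::finite) zpoint \<Rightarrow> real" where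
  "delta z = (if zeta1 z = 0 then 0 else (zeta0 z)\<^sup>2 / zeta1 z)"

definition nbhd_delta :: "real^'n^'n \<Rightarrow> real^'n \<Rightarrow> real \<Rightarrow> ('n::finite) zpoint set" where
  "nbhd_delta M q \<beta> = {z \<in> z_interior M q. delta z \<le> \<beta>}"

definition nbhd_Psi :: "real^'n^'n \<Rightarrow> real^'n \<Rightarrow> real \<Rightarrow> ('n::finite) zpoint set" where
  "nbhd_Psi M q \<tau> = {z \<in> z_interior M q. Psi z \<le> \<tau>}"

text \<open>Only used for \<open>0 \<le> t < 1\<close>.\<close>

definition omega_star :: "real \<Rightarrow> real" where
  "omega_star t = - t - ln (1 - t)"

definition is_direction ::
  "real^'n^'n \<Rightarrow> real^'n \<Rightarrow> real^'n \<Rightarrow> real^'n \<Rightarrow> real^'n \<Rightarrow> real^'n \<Rightarrow> bool" where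
  "is_direction M x s a dx ds \<longleftrightarrow> - (M *v dx) + ds = 0 \<and> s * dx + x * ds = a"

fun rhs_corrector :: "('n::finite) zpoint \<Rightarrow> real^'n" where
  "rhs_corrector (x, s, (v0, v)) = (\<chi> i. rho (v0, v) - x $ i * s $ i + (v $ i)\<^sup>2)"

fun rhs_autocorrector :: "('n::finite) zpoint \<Rightarrow> real^'n" where
  "rhs_autocorrector (x, s, (v0, v)) =
     (\<chi> i. (norm v)\<^sup>2 / (real CARD('n) + 1) - (v $ i)\<^sup>2 - x $ i * s $ i)"

fun predictor_point ::
  "('n::finite) zpoint \<Rightarrow> real^'n \<Rightarrow> real^'n \<Rightarrow> real \<Rightarrow> 'n zpoint" where
  "predictor_point (x, s, w) dx ds \<alpha> = (x + \<alpha> *\<^sub>R dx, s + \<alpha> *\<^sub>R ds, (1 - \<alpha>) *\<^sub>R w)"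

fun corrector_point ::
  "('n::finite) zpoint \<Rightarrow> real^'n \<Rightarrow> real^'n \<Rightarrow> real \<Rightarrow> 'n zpoint" where
  "corrector_point (x, s, w) dx ds \<alpha> = (x + \<alpha> *\<^sub>R dx, s + \<alpha> *\<^sub>R ds, w)"

text \<open>The steps of the algorithm are relations between the current and the next point. There is
  a predictor step only if the maximum that defines the step length is attained.\<close>

definition predictor_step ::
  "real^'n^'n \<Rightarrow> real^'n \<Rightarrow> real \<Rightarrow> ('n::finite) zpoint \<Rightarrow> 'n zpoint \<Rightarrow> bool" where
  "predictor_step M q \<tau> z z' \<longleftrightarrow> (\<exists>dx ds \<alpha>\<^sub>p.
      is_direction M (fst z) (fst (snd z)) (rhs_autocorrector z) dx ds \<and>
      (let S = {\<alpha> \<in> {0..1}. predictor_point z dx ds \<alpha> \<in> nbhd_Psi M q \<tau>}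
       in \<alpha>\<^sub>p \<in> S \<and> (\<forall>\<alpha>\<in>S. \<alpha> \<le> \<alpha>\<^sub>p)) \<and>
      z' = predictor_point z dx ds \<alpha>\<^sub>p)"

definition corrector_step ::
  "real^'n^'n \<Rightarrow> real^'n \<Rightarrow> real \<Rightarrow> ('n::finite) zpoint \<Rightarrow> 'n zpoint \<Rightarrow> bool" where
  "corrector_step M q \<beta> z z' \<longleftrightarrow> z \<notin> nbhd_delta M q \<beta> \<and> (\<exists>dx ds \<alpha>\<^sub>c.
      is_direction M (fst z) (fst (snd z)) (rhs_corrector z) dx ds \<and>
      (let S = {\<alpha> \<in> {0..1}. corrector_point z dx ds \<alpha> \<in> z_interior M q}
       in \<alpha>\<^sub>c \<in> S \<and>
          (\<forall>\<alpha>\<in>S. barrier_F (corrector_point z dx ds \<alpha>\<^sub>c) \<le> barrier_F (corrector_point z dx ds \<alpha>))) \<and>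
      z' = corrector_point z dx ds \<alpha>\<^sub>c)"

definition outer_iteration ::
  "real^'n^'n \<Rightarrow> real^'n \<Rightarrow> real \<Rightarrow> real \<Rightarrow> real \<Rightarrow> ('n::finite) zpoint \<Rightarrow> 'n zpoint \<Rightarrow> bool" where
  "outer_iteration M q \<epsilon> \<beta> \<tau> z z' \<longleftrightarrow> v0_coord z > \<epsilon> \<and>
     (\<exists>y. predictor_step M q \<tau> z y \<and> (corrector_step M q \<beta>)\<^sup>*\<^sup>* y z' \<and> z' \<in> nbhd_delta M q \<beta>)"

text \<open>\<open>Z 0, ..., Z K\<close> are the points after 0, ..., K passes through the outer loop. The
  algorithm may go on after the K-th pass.\<close>

definition ac_ipa_run ::
  "real^'n^'n \<Rightarrow> real^'n \<Rightarrow> real \<Rightarrow> real \<Rightarrow> real \<Rightarrow> ('n::finite) zpoint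
    \<Rightarrow> nat \<Rightarrow> (nat \<Rightarrow> 'n zpoint) \<Rightarrow> bool" where
  "ac_ipa_run M q \<epsilon> \<beta> \<tau> z0 K Z \<longleftrightarrow>
     Z 0 = z0 \<and> (\<forall>k<K. outer_iteration M q \<epsilon> \<beta> \<tau> (Z k) (Z (Suc k)))"

end

theory Submission
  imports Defs
begin

text \<open>
  Write \<open>m = n + 1\<close>, \<open>V\<close> for the initial and \<open>y\<close> for the current first target coordinate. The
  predictor direction linearizes the auto-correcting right-hand side in such a way that, after a
  step of length \<open>\<alpha> = 1 - \<theta>\<close>, the vector of residuals minus their mean \<open>\<rho>\<close> is exactly
  \<open>\<theta>\<close> times the old one plus \<open>\<alpha>\<^sup>2\<close> times an error vector that consists of the quadratic terms
  \<open>\<Delta>x \<Delta>s\<close> and of \<open>v\<^sup>2\<close> (\<open>resid_predictor_point\<close>). Since \<open>\<rho>\<close> shrinks no faster than \<open>\<theta>\<close>,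
  the relative deviation of the residuals grows by at most \<open>error / (\<theta> \<rho>)\<close>.

  There is room for such growth. The proximity condition \<open>\<delta> \<le> \<beta>\<close> bounds the relative deviation by
  \<open>\<beta> / (1 - \<beta>)\<close> (\<open>proximity_imp_dist_le\<close>), while twice that value still guarantees
  \<open>\<Psi> \<le> \<tau>\<close> (\<open>neg_sum_ln_le_omega_star\<close>). Hence every \<open>\<theta>\<close> with
  \<open>error \<le> \<theta> \<rho> \<beta> / (1 - \<beta>)\<close> is admissible (\<open>predictor_point_in_nbhd_Psi\<close>), and the maximal
  step does at least as well.

  It remains to see that the error is of order \<open>y\<^sup>2 / V\<close>, whereas \<open>\<rho>\<close> is of order \<open>y / m\<close>. All target
  vectors lie on one ray, so \<open>\<parallel>v\<parallel>\<^sup>2 \<le> y\<^sup>2 / V\<close>; this gives the \<open>v\<close>-part of the error and also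
  \<open>m \<rho> \<ge> y (V - y) / V\<close>. For \<open>\<Delta>x \<Delta>s\<close> one exchanges, by a principal pivot, the roles of \<open>x\<close> and \<open>s\<close>
  so that the variables that are positive at the solution depend linearly, through a matrix of norm
  \<open>\<kappa>\<close>, on those that vanish there. Monotonicity bounds the vanishing variables by \<open>y / \<sigma>\<close> in total, and
  \<open>y \<le> \<sigma>\<^sup>2 / (4 \<kappa>)\<close> then keeps the others above \<open>3 \<sigma> / 4\<close>. The linear system for the direction
  makes the vanishing components of the direction of size \<open>y / \<sigma>\<close>, the others \<open>\<kappa>\<close> times that, so
  the products are of size \<open>\<kappa> y\<^sup>2 / \<sigma>\<^sup>2 \<le> y\<^sup>2 / (4 V)\<close> up to a constant
  (\<open>pivoted_direction_products\<close>). Estimating the products in the sum norm, and only one factor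
  in the maximum norm, keeps this constant independent of \<open>n\<close>. Solving
  \<open>error = \<theta> \<rho> \<beta> / (1 - \<beta>)\<close> for \<open>\<theta>\<close> yields the quadratic rate.
\<close>

section \<open>Barrier and proximity measure\<close>

declare resid.simps [simp del] resid_hat.simps [simp del] rho.simps [simp del]

lemma omega_star_sums:
  assumes "\<bar>t\<bar> < 1"
  shows "(\<lambda>k. t ^ (k + 2) / real (k + 2)) sums omega_star t"
proof -
  have "(\<lambda>n. - ((- (- t)) ^ n) / real n) sums ln (1 + (- t))"
    by (rule ln_series') (use assms in simp)
  hence "(\<lambda>n. t ^ n / real n) sums (- ln (1 - t))"
    using sums_minus by fastforce
  hence "(\<lambda>k. t ^ (k + 2) / real (k + 2)) sums (- ln (1 - t) - (\<Sum>k<2. t ^ k / real k))"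
    by (rule sums_split_initial_segment)
  moreover have "- ln (1 - t) - (\<Sum>k<2. t ^ k / real k) = omega_star t"
    by (simp add: omega_star_def numeral_2_eq_2)
  ultimately show ?thesis by simp
qed

text \<open>In the power series of \<open>omega_star\<close> every term has degree at least 2, and the remaining
  powers of \<open>t\<close> are at most those of \<open>c\<close>. Negative \<open>t\<close> is covered by the same comparison.\<close>

lemma omega_star_quadratic_bound:
  assumes "\<bar>t\<bar> \<le> c" "0 < c" "c < 1"
  shows "omega_star t \<le> t\<^sup>2 / c\<^sup>2 * omega_star c"
proof (rule sums_le)
  show "(\<lambda>k. t ^ (k + 2) / real (k + 2)) sums omega_star t"
    by (rule omega_star_sums) (use assms in simp)
  show "(\<lambda>k. t\<^sup>2 / c\<^sup>2 * (c ^ (k + 2) / real (k + 2))) sums (t\<^sup>2 / c\<^sup>2 * omega_star c)"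
    by (intro sums_mult omega_star_sums) (use assms in simp)
  fix k
  have "t ^ k \<le> c ^ k"
    using assms by (metis abs_ge_self abs_ge_zero order_trans power_abs power_mono)
  hence "t\<^sup>2 * t ^ k \<le> t\<^sup>2 * c ^ k" by (simp add: mult_left_mono)
  hence "t ^ (k + 2) / real (k + 2) \<le> t\<^sup>2 * c ^ k / real (k + 2)"
    by (intro divide_right_mono) (simp_all only: power_add mult.commute of_nat_0_le_iff)
  also have "\<dots> = t\<^sup>2 / c\<^sup>2 * (c ^ (k + 2) / real (k + 2))"
    using assms by (simp add: power_add power2_eq_square)
  finally show "t ^ (k + 2) / real (k + 2) \<le> t\<^sup>2 / c\<^sup>2 * (c ^ (k + 2) / real (k + 2))" .
qed

text \<open>As the deviations \<open>1 - u\<close> sum to zero, \<open>- ln u\<close> may be replaced by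
  \<open>omega_star (1 - u)\<close>, for which the quadratic bound adds up to a bound in the Euclidean norm.\<close>

lemma neg_sum_ln_le_omega_star:
  fixes u :: "'a::finite \<Rightarrow> real"
  assumes "(\<Sum>i\<in>UNIV. u i - 1) = 0" and dist: "(\<Sum>i\<in>UNIV. (u i - 1)\<^sup>2) \<le> c\<^sup>2"
    and c: "0 < c" "c < 1"
  shows "- (\<Sum>i\<in>UNIV. ln (u i)) \<le> omega_star c"
proof -
  have abs: "\<bar>1 - u i\<bar> \<le> c" for i
  proof -
    have "(u i - 1)\<^sup>2 \<le> (\<Sum>i\<in>UNIV. (u i - 1)\<^sup>2)" by (rule member_le_sum) auto
    hence "(1 - u i)\<^sup>2 \<le> c\<^sup>2" using dist by (simp add: power2_commute)
    thus ?thesis using c by (metis abs_le_square_iff abs_of_pos)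
  qed
  have pos: "0 \<le> omega_star c"
  proof -
    have "ln (1 - c) \<le> - c" using ln_add_one_self_le_self2[of "- c"] c by simp
    thus ?thesis by (simp add: omega_star_def)
  qed
  have "- (\<Sum>i\<in>UNIV. ln (u i)) = (\<Sum>i\<in>UNIV. omega_star (1 - u i))"
    using assms(1) by (simp add: omega_star_def sum_subtractf sum_negf)
  also have "\<dots> \<le> (\<Sum>i\<in>UNIV. (1 - u i)\<^sup>2 / c\<^sup>2 * omega_star c)"
    by (intro sum_mono omega_star_quadratic_bound abs c)
  also have "\<dots> = (\<Sum>i\<in>UNIV. (u i - 1)\<^sup>2) / c\<^sup>2 * omega_star c"
    by (simp add: sum_distrib_right sum_divide_distrib power2_commute)
  also have "\<dots> \<le> 1 * omega_star c"
    using dist c pos by (intro mult_right_mono) (auto simp: divide_le_eq_1)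
  finally show ?thesis by simp
qed

text \<open>Here \<open>u\<close> stands for the squared scaled residuals. With \<open>p = 1 / u - 1\<close> the hypothesis reads
  \<open>\<Sum> u p\<^sup>2 \<le> \<beta> \<parallel>p\<parallel>\<close>. It first gives \<open>\<parallel>p\<parallel> \<le> R = \<beta> / (1 - \<beta>)\<close>, hence a range for each \<open>u\<close>. In that range
  \<open>\<Sum> (u - 1)\<^sup>2 = \<Sum> u\<^sup>2 p\<^sup>2\<close> can be compared with \<open>\<Sum> u p\<^sup>2\<close> and \<open>\<Sum> p\<^sup>2\<close> (a Kantorovich type
  inequality). Multiplying \<open>\<parallel>p\<parallel>\<close> by the maximal \<open>u\<close> would only give
  \<open>\<beta> / (1 - 2 \<beta>)\<close>, which leaves no uniform margin below \<open>2 \<beta> / (1 - \<beta>)\<close> as \<open>\<beta>\<close> tends to 1/3.\<close>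

lemma proximity_imp_dist_le:
  fixes u :: "'a::finite \<Rightarrow> real"
  assumes u: "\<And>i. u i > 0" and mean: "(\<Sum>i\<in>UNIV. u i - 1) = 0"
    and prox: "(\<Sum>i\<in>UNIV. (u i - 2 + 1 / u i)) \<le> \<beta> * sqrt (\<Sum>i\<in>UNIV. (1 / u i - 1)\<^sup>2)"
    and \<beta>: "0 < \<beta>" "\<beta> < 1/3"
  shows "(\<Sum>i\<in>UNIV. (u i - 1)\<^sup>2) \<le> (\<beta> / (1 - \<beta>))\<^sup>2"
proof -
  define p where "p i = 1 / u i - 1" for i
  define P where "P = sqrt (\<Sum>i\<in>UNIV. (p i)\<^sup>2)"
  define R where "R = \<beta> / (1 - \<beta>)"
  have P0: "0 \<le> P" unfolding P_def by (simp add: sum_nonneg)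
  have P2: "P\<^sup>2 = (\<Sum>i\<in>UNIV. (p i)\<^sup>2)" unfolding P_def by (simp add: sum_nonneg)
  have pP: "\<bar>p i\<bar> \<le> P" for i
    unfolding P_def by (rule real_le_rsqrt, subst power2_abs, rule member_le_sum) auto
  have up: "u i * (1 + p i) = 1" for i using u[of i] by (simp add: p_def)
  have "u i * (p i)\<^sup>2 = u i - 2 + 1 / u i" for i
    using u[of i] by (simp add: p_def field_simps power2_eq_square)
  hence weighted: "(\<Sum>i\<in>UNIV. u i * (p i)\<^sup>2) \<le> \<beta> * P"
    using prox by (simp add: P_def p_def)
  \<comment> \<open>Since \<open>u \<ge> 1 / (1 + P)\<close>, the weighted sum dominates \<open>P\<^sup>2 / (1 + P)\<close>.\<close>
  have "1 \<le> u i * (1 + P)" for i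
  proof -
    have "u i * (1 + p i) \<le> u i * (1 + P)" using u[of i] pP[of i] by (intro mult_left_mono) auto
    thus ?thesis using up[of i] by simp
  qed
  hence "(p i)\<^sup>2 \<le> u i * (1 + P) * (p i)\<^sup>2" for i
    using mult_right_mono[of 1 "u i * (1 + P)" "(p i)\<^sup>2"] by simp
  hence "P\<^sup>2 \<le> (\<Sum>i\<in>UNIV. u i * (1 + P) * (p i)\<^sup>2)" unfolding P2 by (rule sum_mono)
  also have "\<dots> = (1 + P) * (\<Sum>i\<in>UNIV. u i * (p i)\<^sup>2)" by (simp add: sum_distrib_left mult_ac)
  also have "\<dots> \<le> (1 + P) * (\<beta> * P)" using weighted P0 by (intro mult_left_mono) auto
  finally have "P * P \<le> P * (\<beta> * (1 + P))" by (simp add: power2_eq_square algebra_simps)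
  hence "P \<le> \<beta> * (1 + P)" using P0 \<beta> by (cases "P = 0") auto
  hence PR: "P \<le> R" using \<beta> unfolding R_def by (simp add: pos_le_divide_eq algebra_simps)
  have R: "0 < R" "R < 1/2" using \<beta> by (auto simp: R_def field_simps)
  \<comment> \<open>From \<open>u (1 + p) = 1\<close> follows \<open>u\<^sup>2 (1 - p\<^sup>2) = 2 u - 1\<close>; multiply by \<open>p\<^sup>2\<close>.\<close>
  have "(1 - R\<^sup>2) * (u i - 1)\<^sup>2 \<le> 2 * (u i * (p i)\<^sup>2) - (p i)\<^sup>2" for i
  proof -
    have "(p i)\<^sup>2 \<le> R\<^sup>2" using pP[of i] PR R by (intro power2_le_iff_abs_le[THEN iffD2]) auto
    hence "(1 - R\<^sup>2) * (u i)\<^sup>2 \<le> (1 - (p i)\<^sup>2) * (u i)\<^sup>2" by (intro mult_right_mono) auto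
    also have "\<dots> = 2 * u i * (u i * (1 + p i)) - (u i * (1 + p i))\<^sup>2"
      by (simp add: power2_eq_square algebra_simps)
    finally have "(1 - R\<^sup>2) * (u i)\<^sup>2 \<le> 2 * u i - 1" unfolding up by simp
    hence "(1 - R\<^sup>2) * (u i)\<^sup>2 * (p i)\<^sup>2 \<le> (2 * u i - 1) * (p i)\<^sup>2" by (rule mult_right_mono) simp
    moreover have "(u i - 1)\<^sup>2 = (u i)\<^sup>2 * (p i)\<^sup>2"
    proof -
      have "u i - 1 = - (u i * p i)" using up[of i] by (simp add: algebra_simps)
      thus ?thesis by (simp add: power_mult_distrib)
    qed
    ultimately show ?thesis by (simp add: algebra_simps)
  qed
  hence "(\<Sum>i\<in>UNIV. (1 - R\<^sup>2) * (u i - 1)\<^sup>2) \<le> (\<Sum>i\<in>UNIV. 2 * (u i * (p i)\<^sup>2) - (p i)\<^sup>2)"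
    by (rule sum_mono)
  hence "(1 - R\<^sup>2) * (\<Sum>i\<in>UNIV. (u i - 1)\<^sup>2) \<le> 2 * (\<Sum>i\<in>UNIV. u i * (p i)\<^sup>2) - P\<^sup>2"
    by (simp add: P2 sum_subtractf sum_distrib_left)
  also have "\<dots> \<le> 2 * (\<beta> * P) - P\<^sup>2" using weighted by simp
  also have "\<dots> \<le> \<beta>\<^sup>2"
    using zero_le_power2[of "P - \<beta>"] by (simp add: power2_diff algebra_simps)
  also have "\<dots> \<le> (1 - R\<^sup>2) * R\<^sup>2"
  proof -
    have bR: "\<beta> = R * (1 - \<beta>)" using \<beta> by (simp add: R_def)
    have "R \<le> 3/2 * \<beta>" using \<beta> R bR by (simp add: R_def field_simps)
    hence "R\<^sup>2 \<le> (3/2 * \<beta>)\<^sup>2" using R by (intro power_mono) auto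
    moreover have "\<beta>\<^sup>2 \<le> \<beta> * (1/3)" using \<beta> unfolding power2_eq_square by (intro mult_left_mono) auto
    ultimately have "(1 - 2 * \<beta> + \<beta>\<^sup>2) \<le> 1 - R\<^sup>2" using \<beta> by (simp add: power_mult_distrib power_divide)
    hence "(1 - \<beta>)\<^sup>2 \<le> 1 - R\<^sup>2" by (simp add: power2_diff)
    hence "(1 - \<beta>)\<^sup>2 * R\<^sup>2 \<le> (1 - R\<^sup>2) * R\<^sup>2" by (rule mult_right_mono) simp
    moreover have "(1 - \<beta>)\<^sup>2 * R\<^sup>2 = \<beta>\<^sup>2"
      using bR by (metis mult.commute power_mult_distrib)
    ultimately show ?thesis by simp
  qed
  finally have "(1 - R\<^sup>2) * (\<Sum>i\<in>UNIV. (u i - 1)\<^sup>2) \<le> (1 - R\<^sup>2) * R\<^sup>2" .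
  moreover have "0 < 1 - R\<^sup>2" using R power_strict_mono[of R 1 2] by simp
  ultimately show ?thesis unfolding R_def[symmetric] by simp
qed

lemma sum_option: "(\<Sum>i\<in>UNIV. f i) = f None + (\<Sum>j\<in>UNIV. f (Some j))"
  for f :: "'n::finite option \<Rightarrow> real"
  by (simp add: UNIV_option_conv sum.reindex)

lemma norm_vec_sq: "(norm (v::real^'a::finite))\<^sup>2 = (\<Sum>i\<in>UNIV. (v $ i)\<^sup>2)"
  by (simp add: norm_vec_def L2_set_def sum_nonneg)

lemma sum_resid:
  fixes x s v :: "real^'n"
  shows "(\<Sum>i\<in>UNIV. resid (x, s, (v0, v)) $ i) = (real CARD('n) + 1) * rho (v0, v)"
  by (simp add: resid.simps rho.simps sum_option inner_vec_def norm_vec_sq sum_subtractf)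

lemma z_interior_resid_pos:
  assumes "z \<in> z_interior M q"
  shows "resid z $ i > 0" "rho (snd (snd z)) > 0"
  using assms by (auto simp: resid.simps rho.simps z_interior_def w_interior_def add_pos_pos split: option.split)

lemma resid_ratio_mean:
  fixes x s v :: "real^'n"
  assumes "rho (v0, v) > 0"
  shows "(\<Sum>i\<in>UNIV. resid (x, s, (v0, v)) $ i / rho (v0, v) - 1) = 0"
proof -
  have "(\<Sum>i\<in>UNIV. resid (x, s, (v0, v)) $ i / rho (v0, v)) = real CARD('n) + 1"
    using assms by (simp add: sum_divide_distrib[symmetric] sum_resid)
  thus ?thesis by (simp add: sum_subtractf)
qed

lemma nbhd_delta_resid_dist:
  fixes x s v :: "real^'n"
  assumes z: "(x, s, (v0, v)) \<in> nbhd_delta M q \<beta>" and \<beta>: "0 < \<beta>" "\<beta> < 1/3"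
  shows "norm (resid (x, s, (v0, v)) - (\<chi> i. rho (v0, v))) \<le> \<beta> / (1 - \<beta>) * rho (v0, v)"
proof -
  let ?z = "(x, s, (v0, v))" and ?\<rho> = "rho (v0, v)"
  define u where "u i = resid ?z $ i / ?\<rho>" for i
  have int: "?z \<in> z_interior M q" and del: "delta ?z \<le> \<beta>"
    using z by (auto simp: nbhd_delta_def)
  have rp: "resid ?z $ i > 0" for i by (rule z_interior_resid_pos[OF int])
  have \<rho>: "?\<rho> > 0" using z_interior_resid_pos[OF int] by simp
  have u: "u i > 0" for i using rp \<rho> by (simp add: u_def)
  have hat2: "(resid_hat ?z $ i)\<^sup>2 = u i" and hatp: "resid_hat ?z $ i > 0" for i
    using u[of i] by (auto simp: u_def resid_hat.simps)
  have mean: "(\<Sum>i\<in>UNIV. u i - 1) = 0" unfolding u_def by (rule resid_ratio_mean[OF \<rho>])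
  have z1: "zeta1 ?z = sqrt (\<Sum>i\<in>UNIV. (1 / u i - 1)\<^sup>2)"
    by (simp add: zeta1_def norm_vec_def L2_set_def hat2)
  have z0: "(zeta0 ?z)\<^sup>2 = (\<Sum>i\<in>UNIV. u i - 2 + 1 / u i)"
  proof -
    have "(resid_hat ?z $ i - 1 / resid_hat ?z $ i)\<^sup>2 = u i - 2 + 1 / u i" for i
      using hatp[of i] unfolding hat2[symmetric] power2_diff
      by (simp add: power_divide)
    thus ?thesis by (simp add: zeta0_def norm_vec_sq)
  qed
  have "(zeta0 ?z)\<^sup>2 \<le> \<beta> * zeta1 ?z"
  proof (cases "zeta1 ?z = 0")
    case True
    hence "\<forall>i\<in>UNIV. (1 / u i - 1)\<^sup>2 = 0"
      unfolding z1 by (subst (asm) real_sqrt_eq_0_iff, subst (asm) sum_nonneg_eq_0_iff) auto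
    hence "u i = 1" for i using u[of i] by (simp add: field_simps)
    thus ?thesis using True by (simp add: z0)
  next
    case False
    moreover have "zeta1 ?z \<ge> 0" by (simp add: zeta1_def)
    ultimately show ?thesis using del by (simp add: delta_def divide_le_eq)
  qed
  hence "(\<Sum>i\<in>UNIV. (u i - 1)\<^sup>2) \<le> (\<beta> / (1 - \<beta>))\<^sup>2"
    unfolding z0 z1 by (intro proximity_imp_dist_le u mean \<beta>)
  hence "?\<rho>\<^sup>2 * (\<Sum>i\<in>UNIV. (u i - 1)\<^sup>2) \<le> ?\<rho>\<^sup>2 * (\<beta> / (1 - \<beta>))\<^sup>2"
    by (rule mult_left_mono) simp
  moreover have "(norm (resid ?z - (\<chi> i. ?\<rho>)))\<^sup>2 = ?\<rho>\<^sup>2 * (\<Sum>i\<in>UNIV. (u i - 1)\<^sup>2)"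
  proof -
    have "(resid ?z $ i - ?\<rho>)\<^sup>2 = ?\<rho>\<^sup>2 * (u i - 1)\<^sup>2" for i
    proof -
      have "resid ?z $ i - ?\<rho> = ?\<rho> * (u i - 1)"
        using \<rho> by (simp add: u_def right_diff_distrib)
      thus ?thesis by (simp add: power_mult_distrib)
    qed
    thus ?thesis by (simp add: norm_vec_sq sum_distrib_left)
  qed
  ultimately have "(norm (resid ?z - (\<chi> i. ?\<rho>)))\<^sup>2 \<le> (\<beta> / (1 - \<beta>) * ?\<rho>)\<^sup>2"
    by (metis mult.commute power_mult_distrib)
  thus ?thesis by (rule power2_le_imp_le) (use \<beta> \<rho> in simp)
qed

text \<open>Since \<open>c < 1\<close>, the hypothesis on the distance also keeps the residuals positive, so that
  the point stays in the domain of the barrier.\<close>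

lemma Psi_le_omega_star:
  fixes x s v :: "real^'n"
  assumes \<rho>: "rho (v0, v) > 0" and c: "0 < c" "c < 1"
    and dist: "norm (resid (x, s, (v0, v)) - (\<chi> i. rho (v0, v))) \<le> c * rho (v0, v)"
  shows "resid (x, s, (v0, v)) $ i > 0" "Psi (x, s, (v0, v)) \<le> omega_star c"
proof -
  let ?z = "(x, s, (v0, v))" and ?\<rho> = "rho (v0, v)"
  have pos: "resid ?z $ i > 0" for i
  proof -
    have "\<bar>resid ?z $ i - ?\<rho>\<bar> \<le> c * ?\<rho>"
      using component_le_norm_cart[of "resid ?z - (\<chi> i. ?\<rho>)" i] dist
      by simp
    moreover have "c * ?\<rho> < 1 * ?\<rho>" using c \<rho> by (intro mult_strict_right_mono) auto
    ultimately show ?thesis by linarith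
  qed
  thus "resid ?z $ i > 0" .
  define u where "u i = resid ?z $ i / ?\<rho>" for i
  have u: "(resid_hat ?z $ i)\<^sup>2 = u i" for i
    using pos[of i] \<rho> by (simp add: u_def resid_hat.simps)
  have "(u i - 1)\<^sup>2 = (resid ?z $ i - ?\<rho>)\<^sup>2 / ?\<rho>\<^sup>2" for i
  proof -
    have "u i - 1 = (resid ?z $ i - ?\<rho>) / ?\<rho>"
      using \<rho> by (simp add: u_def diff_divide_distrib)
    thus ?thesis by (simp add: power_divide)
  qed
  hence "(\<Sum>i\<in>UNIV. (u i - 1)\<^sup>2) = (norm (resid ?z - (\<chi> i. ?\<rho>)))\<^sup>2 / ?\<rho>\<^sup>2"
    by (simp add: norm_vec_sq sum_divide_distrib)
  also have "\<dots> \<le> (c * ?\<rho>)\<^sup>2 / ?\<rho>\<^sup>2"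
    by (intro divide_right_mono power_mono dist) auto
  also have "\<dots> = c\<^sup>2" using \<rho> by (simp add: power_mult_distrib)
  finally have "- (\<Sum>i\<in>UNIV. ln (u i)) \<le> omega_star c"
    using resid_ratio_mean[OF \<rho>] c unfolding u_def by (intro neg_sum_ln_le_omega_star)
  thus "Psi ?z \<le> omega_star c" by (simp add: Psi_def u)
qed


section \<open>Residuals along the predictor direction\<close>

text \<open>The second-order part of the residuals along the predictor direction, relative to the
  second-order part of their mean. Its coordinates sum to zero.\<close>

definition predictor_err :: "real^'n \<Rightarrow> real^'n \<Rightarrow> real^'n \<Rightarrow> real^('n option)" where
  "predictor_err v dx ds = (\<chi> i. case i of
       None \<Rightarrow> (norm v)\<^sup>2 / (real CARD('n) + 1) - dx \<bullet> ds
     | Some j \<Rightarrow> (norm v)\<^sup>2 / (real CARD('n) + 1) - (v $ j)\<^sup>2 + dx $ j * ds $ j)"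

text \<open>The part in \<open>v\<close> is the vector \<open>(0, v\<^sup>2)\<close> made orthogonal to the all-ones vector, up to sign, so its
  norm is at most that of \<open>v\<^sup>2\<close>. The part in \<open>dx ds\<close> has norm at most \<open>sqrt 2 * D\<close>;
  3/2 is a rational upper bound of \<open>sqrt 2\<close>.\<close>

lemma norm_predictor_err_le:
  fixes v dx ds :: "real^'n"
  assumes D: "(\<Sum>j\<in>UNIV. \<bar>dx $ j * ds $ j\<bar>) \<le> D"
  shows "norm (predictor_err v dx ds) \<le> (norm v)\<^sup>2 + 3/2 * D"
proof -
  let ?m = "real CARD('n) + 1" and ?g = "(norm v)\<^sup>2"
  define e1 :: "real^('n option)" where
    "e1 = (\<chi> i. case i of None \<Rightarrow> ?g / ?m | Some j \<Rightarrow> ?g / ?m - (v $ j)\<^sup>2)"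
  define e2 :: "real^('n option)" where
    "e2 = (\<chi> i. case i of None \<Rightarrow> - (dx \<bullet> ds) | Some j \<Rightarrow> dx $ j * ds $ j)"
  define d where "d j = dx $ j * ds $ j" for j
  have split: "predictor_err v dx ds = e1 + e2"
    by (simp add: vec_eq_iff predictor_err_def e1_def e2_def split: option.split)
  have sq: "(\<Sum>j\<in>UNIV. (f j)\<^sup>2) \<le> (\<Sum>j\<in>UNIV. \<bar>f j\<bar>)\<^sup>2" for f :: "'n \<Rightarrow> real"
  proof -
    have "(L2_set f UNIV)\<^sup>2 \<le> (\<Sum>j\<in>UNIV. \<bar>f j\<bar>)\<^sup>2"
      by (intro power_mono L2_set_le_sum_abs L2_set_nonneg)
    thus ?thesis by (simp add: L2_set_def sum_nonneg)
  qed
  have square: "(\<Sum>j\<in>UNIV. (c - (v $ j)\<^sup>2)\<^sup>2)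
      = real CARD('n) * c\<^sup>2 - 2 * c * ?g + (\<Sum>j\<in>UNIV. ((v $ j)\<^sup>2)\<^sup>2)" for c
    by (simp add: power2_diff sum.distrib sum_subtractf norm_vec_sq sum_distrib_left mult.assoc)
  have "(norm e1)\<^sup>2 = (?g / ?m)\<^sup>2 + (\<Sum>j\<in>UNIV. (?g / ?m - (v $ j)\<^sup>2)\<^sup>2)"
    by (simp add: norm_vec_sq sum_option e1_def)
  also have "\<dots> = ?m * (?g / ?m)\<^sup>2 - 2 * (?g / ?m) * ?g + (\<Sum>j\<in>UNIV. ((v $ j)\<^sup>2)\<^sup>2)"
    unfolding square by (simp add: algebra_simps)
  also have "\<dots> = (\<Sum>j\<in>UNIV. ((v $ j)\<^sup>2)\<^sup>2) - ?g\<^sup>2 / ?m"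
  proof -
    have "m * (?g / m)\<^sup>2 - 2 * (?g / m) * ?g = - (?g\<^sup>2 / m)" if "m \<noteq> 0" for m
      using that by (simp add: power2_eq_square)
    thus ?thesis by (smt (verit) of_nat_0_le_iff)
  qed
  also have "\<dots> \<le> (\<Sum>j\<in>UNIV. ((v $ j)\<^sup>2)\<^sup>2)" by simp
  also have "\<dots> \<le> (\<Sum>j\<in>UNIV. \<bar>(v $ j)\<^sup>2\<bar>)\<^sup>2" by (rule sq)
  also have "\<dots> = ?g\<^sup>2" by (simp add: norm_vec_sq)
  finally have e1: "norm e1 \<le> ?g" by (rule power2_le_imp_le) simp
  have D0: "0 \<le> D" using D by (rule order_trans[rotated]) (simp add: sum_nonneg)
  have inner: "dx \<bullet> ds = (\<Sum>j\<in>UNIV. d j)" by (simp add: inner_vec_def d_def)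
  have "\<bar>dx \<bullet> ds\<bar> \<le> (\<Sum>j\<in>UNIV. \<bar>d j\<bar>)" unfolding inner by (rule sum_abs)
  hence inD: "\<bar>dx \<bullet> ds\<bar> \<le> D" using D by (simp add: d_def)
  have "(\<Sum>j\<in>UNIV. \<bar>d j\<bar>)\<^sup>2 \<le> D\<^sup>2"
    using D by (intro power_mono) (simp_all add: d_def sum_nonneg)
  hence "(\<Sum>j\<in>UNIV. (d j)\<^sup>2) \<le> D\<^sup>2" using sq[of d] by linarith
  moreover have "(dx \<bullet> ds)\<^sup>2 \<le> D\<^sup>2" using inD D0 by (metis abs_le_square_iff abs_of_nonneg)
  moreover have "(norm e2)\<^sup>2 = (dx \<bullet> ds)\<^sup>2 + (\<Sum>j\<in>UNIV. (d j)\<^sup>2)"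
    by (simp add: norm_vec_sq sum_option e2_def d_def)
  ultimately have "(norm e2)\<^sup>2 \<le> D\<^sup>2 + D\<^sup>2" by linarith
  also have "\<dots> \<le> (3/2 * D)\<^sup>2" by (simp add: power2_eq_square)
  finally have e2: "norm e2 \<le> 3/2 * D" by (rule power2_le_imp_le) (use D0 in simp)
  show ?thesis unfolding split using norm_triangle_ineq[of e1 e2] e1 e2 by linarith
qed

text \<open>The auto-corrector right-hand side is chosen so that, to first order in \<open>\<alpha>\<close>, all deviations of
  the residuals from their mean shrink by the common factor \<open>1 - \<alpha>\<close>; the identity is exact in \<open>\<alpha>\<close>.\<close>

lemma resid_predictor_point:
  fixes x s v dx ds :: "real^'n"
  assumes "is_direction M x s (rhs_autocorrector (x, s, (v0, v))) dx ds"
  shows "resid (predictor_point (x, s, (v0, v)) dx ds \<alpha>) $ i - rho ((1 - \<alpha>) *\<^sub>R (v0, v))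
    = (1 - \<alpha>) * (resid (x, s, (v0, v)) $ i - rho (v0, v)) + \<alpha>\<^sup>2 * predictor_err v dx ds $ i"
proof -
  let ?m = "real CARD('n) + 1" and ?g = "(norm v)\<^sup>2"
  define G where "G = ?g / ?m"
  have G: "?g = ?m * G" by (simp add: G_def)
  have dir: "s $ j * dx $ j + x $ j * ds $ j = G - (v $ j)\<^sup>2 - x $ j * s $ j" for j
    using assms by (auto simp: G_def is_direction_def vec_eq_iff)
  have "s \<bullet> dx + x \<bullet> ds = (\<Sum>j\<in>UNIV. G - (v $ j)\<^sup>2 - x $ j * s $ j)"
    by (simp add: inner_vec_def sum.distrib[symmetric] dir)
  also have "\<dots> = real CARD('n) * G - ?g - x \<bullet> s"
    by (simp add: sum_subtractf norm_vec_sq inner_vec_def)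
  also have "\<dots> = - G - x \<bullet> s" using G by (simp add: algebra_simps)
  finally have sum: "s \<bullet> dx + x \<bullet> ds = - G - x \<bullet> s" .
  have rho: "rho ((1 - \<alpha>) *\<^sub>R (v0, v)) = (1 - \<alpha>) * rho (v0, v) + \<alpha> * (1 - \<alpha>) * G"
  proof -
    have "(1 - \<alpha>) * v0 - (1 - \<alpha>)\<^sup>2 * ?g = (1 - \<alpha>) * (v0 - ?g) + \<alpha> * (1 - \<alpha>) * ?g"
      by (simp add: algebra_simps power2_eq_square)
    thus ?thesis by (simp add: rho.simps power_mult_distrib add_divide_distrib G_def)
  qed
  show ?thesis
  proof (cases i)
    case None
    have "(x + \<alpha> *\<^sub>R dx) \<bullet> (s + \<alpha> *\<^sub>R ds)
        = x \<bullet> s + \<alpha> * (s \<bullet> dx + x \<bullet> ds) + \<alpha>\<^sup>2 * (dx \<bullet> ds)"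
      by (simp add: inner_add_left inner_add_right inner_commute power2_eq_square algebra_simps)
    thus ?thesis unfolding rho
      by (simp add: None resid.simps predictor_err_def G_def[symmetric] sum)
        (simp add: algebra_simps power2_eq_square)
  next
    case (Some j)
    have "(x $ j + \<alpha> * dx $ j) * (s $ j + \<alpha> * ds $ j)
        = x $ j * s $ j + \<alpha> * (s $ j * dx $ j + x $ j * ds $ j) + \<alpha>\<^sup>2 * (dx $ j * ds $ j)"
      by (simp add: power2_eq_square algebra_simps)
    thus ?thesis unfolding rho
      by (simp add: Some resid.simps predictor_err_def G_def[symmetric] dir power_mult_distrib)
        (simp add: algebra_simps power2_eq_square)
  qed
qed

text \<open>The old deviation and the error each use up half of the admissible relative deviation
  \<open>2 \<beta> / (1 - \<beta>)\<close>. The condition on \<open>\<alpha>\<close> is inherited by all shorter steps, and this is what keeps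
  \<open>x\<close> and \<open>s\<close> positive.\<close>

lemma predictor_point_in_nbhd_Psi:
  fixes x s v dx ds :: "real^'n"
  assumes z: "(x, s, (v0, v)) \<in> nbhd_delta M q \<beta>" and \<beta>: "0 < \<beta>" "\<beta> < 1/3"
    and dir: "is_direction M x s (rhs_autocorrector (x, s, (v0, v))) dx ds"
    and \<alpha>: "0 \<le> \<alpha>" "\<alpha> < 1"
    and err: "\<alpha>\<^sup>2 * norm (predictor_err v dx ds) \<le> (1 - \<alpha>) * (\<beta> / (1 - \<beta>) * rho (v0, v))"
  shows "predictor_point (x, s, (v0, v)) dx ds \<alpha> \<in> nbhd_Psi M q (omega_star (2 * \<beta> / (1 - \<beta>)))"
proof -
  let ?z = "(x, s, (v0, v))" and ?E = "norm (predictor_err v dx ds)"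
  let ?w = "\<lambda>a. (1 - a) *\<^sub>R (v0, v)"
  define R where "R = \<beta> / (1 - \<beta>)"
  have R: "0 < 2 * R" "2 * R < 1" "2 * \<beta> / (1 - \<beta>) = 2 * R" using \<beta> by (auto simp: R_def field_simps)
  have int: "?z \<in> z_interior M q" using z by (simp add: nbhd_delta_def)
  have \<rho>: "rho (v0, v) > 0" using z_interior_resid_pos[OF int] by simp
  have v0: "(norm v)\<^sup>2 < v0" using int by (simp add: z_interior_def w_interior_def)
  have rho_ge: "(1 - a) * rho (v0, v) \<le> rho (?w a)" if "0 \<le> a" "a < 1" for a
  proof -
    have "(1 - a)\<^sup>2 * (norm v)\<^sup>2 \<le> (1 - a) * (norm v)\<^sup>2"
      using that by (intro mult_right_mono) (auto simp: power2_eq_square mult_left_le)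
    hence "(1 - a) * (v0 - (norm v)\<^sup>2) \<le> (1 - a) * v0 - (1 - a)\<^sup>2 * (norm v)\<^sup>2"
      by (simp add: algebra_simps)
    thus ?thesis using that by (simp add: rho.simps power_mult_distrib divide_right_mono)
  qed
  have close: "norm (resid (predictor_point ?z dx ds a) - (\<chi> i. rho (?w a))) \<le> 2 * R * rho (?w a)"
    if a: "0 \<le> a" "a \<le> \<alpha>" for a
  proof -
    have "resid (predictor_point ?z dx ds a) - (\<chi> i. rho (?w a))
        = (1 - a) *\<^sub>R (resid ?z - (\<chi> i. rho (v0, v))) + a\<^sup>2 *\<^sub>R predictor_err v dx ds"
      using resid_predictor_point[OF dir, of a] by (simp add: vec_eq_iff)
    hence "norm (resid (predictor_point ?z dx ds a) - (\<chi> i. rho (?w a)))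
        \<le> (1 - a) * norm (resid ?z - (\<chi> i. rho (v0, v))) + a\<^sup>2 * ?E"
      using a \<alpha> norm_triangle_ineq[of "(1 - a) *\<^sub>R (resid ?z - (\<chi> i. rho (v0, v)))"
          "a\<^sup>2 *\<^sub>R predictor_err v dx ds"] by simp
    also have "\<dots> \<le> (1 - a) * (R * rho (v0, v)) + (1 - a) * (R * rho (v0, v))"
    proof (rule add_mono)
      show "(1 - a) * norm (resid ?z - (\<chi> i. rho (v0, v))) \<le> (1 - a) * (R * rho (v0, v))"
        unfolding R_def using a \<alpha> by (intro mult_left_mono nbhd_delta_resid_dist[OF z \<beta>]) auto
      have "a\<^sup>2 * ?E \<le> \<alpha>\<^sup>2 * ?E" using a by (intro mult_right_mono power_mono) auto
      also have "\<dots> \<le> (1 - \<alpha>) * (R * rho (v0, v))" using err by (simp add: R_def)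
      also have "\<dots> \<le> (1 - a) * (R * rho (v0, v))"
        using a R \<rho> by (intro mult_right_mono) auto
      finally show "a\<^sup>2 * ?E \<le> (1 - a) * (R * rho (v0, v))" .
    qed
    also have "\<dots> = 2 * R * ((1 - a) * rho (v0, v))" by simp
    also have "\<dots> \<le> 2 * R * rho (?w a)"
      using R a \<alpha> by (intro mult_left_mono rho_ge) auto
    finally show ?thesis .
  qed
  have rhow: "0 < rho ((1 - a) * v0, (1 - a) *\<^sub>R v)" if "0 \<le> a" "a \<le> \<alpha>" for a
  proof -
    have "0 < (1 - a) * rho (v0, v)" using that \<alpha> \<rho> by simp
    thus ?thesis using rho_ge[of a] that \<alpha> by simp
  qed
  have rpos: "resid (predictor_point ?z dx ds a) $ i > 0" if "0 \<le> a" "a \<le> \<alpha>" for a i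
    using Psi_le_omega_star(1)[OF rhow[OF that] R(1,2)] close[OF that] by simp
  have Psi: "Psi (predictor_point ?z dx ds \<alpha>) \<le> omega_star (2 * R)"
    using Psi_le_omega_star(2)[OF rhow R(1,2), of \<alpha>] close[of \<alpha>] \<alpha> by simp
  have prod: "((1 - a) * v $ j)\<^sup>2 < (x $ j + a * dx $ j) * (s $ j + a * ds $ j)"
    if "0 \<le> a" "a \<le> \<alpha>" for a j
    using rpos[OF that, of "Some j"] by (simp add: resid.simps)
  have nz: "x $ j + a * dx $ j \<noteq> 0" "s $ j + a * ds $ j \<noteq> 0" if "0 \<le> a" "a \<le> \<alpha>" for a j
    using prod[OF that, of j] zero_le_power2[of "(1 - a) * v $ j"] by (auto simp del: zero_le_power2)
  have xs: "x $ j > 0" "s $ j > 0" for j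
    using int by (auto simp: z_interior_def lcp_interior_def)
  \<comment> \<open>A coordinate that changed sign would vanish for some shorter step, where the product
     with its partner is still positive.\<close>
  have line: "0 < p + \<alpha> * d" if p: "0 < p" and nz: "\<And>a. 0 \<le> a \<Longrightarrow> a \<le> \<alpha> \<Longrightarrow> p + a * d \<noteq> 0"
    for p d :: real
  proof (rule ccontr)
    assume neg: "\<not> 0 < p + \<alpha> * d"
    hence d: "d < 0" using p \<alpha> by (smt (verit) mult_nonneg_nonneg)
    have "p / (- d) \<le> \<alpha>" using neg d by (simp add: field_simps)
    moreover have "0 \<le> p / (- d)" using p d by (simp add: divide_pos_neg less_imp_le)
    moreover have "p + p / (- d) * d = 0" using d by simp
    ultimately show False using nz by blast
  qed
  have "0 < x $ j + \<alpha> * dx $ j" for j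
    by (rule line) (use xs nz in auto)
  moreover have "0 < s $ j + \<alpha> * ds $ j" for j
    by (rule line) (use xs nz in auto)
  moreover have "- (M *v (x + \<alpha> *\<^sub>R dx)) + (s + \<alpha> *\<^sub>R ds) = q"
  proof -
    have "- (M *v x) + s = q" using int by (auto simp: z_interior_def lcp_interior_def lcp_feasible_def)
    moreover have "ds = M *v dx" using dir by (simp add: is_direction_def)
    ultimately show ?thesis
      by (simp add: matrix_vector_right_distrib matrix_vector_mult_scaleR)
  qed
  moreover have "(norm ((1 - \<alpha>) *\<^sub>R v))\<^sup>2 < (1 - \<alpha>) * v0"
    using rhow[of \<alpha>] \<alpha> by (simp add: rho.simps zero_less_divide_iff)
  moreover have "(x + \<alpha> *\<^sub>R dx) \<bullet> (s + \<alpha> *\<^sub>R ds) < (1 - \<alpha>) * v0"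
    using rpos[of \<alpha> None] \<alpha> by (simp add: resid.simps)
  ultimately have "predictor_point ?z dx ds \<alpha> \<in> z_interior M q"
    using prod[of \<alpha>] \<alpha>
    by (auto simp: z_interior_def lcp_interior_def lcp_feasible_def w_interior_def less_imp_le)
  thus ?thesis using Psi by (simp add: nbhd_Psi_def R)
qed

section \<open>The principal pivot transform\<close>

definition restrict_vec :: "'n set \<Rightarrow> real^'n \<Rightarrow> real^'n" where
  "restrict_vec I y = (\<chi> i. if i \<in> I then y $ i else 0)"

definition mix_vec :: "'n set \<Rightarrow> real^'n \<Rightarrow> real^'n \<Rightarrow> real^'n" where
  "mix_vec B a b = (\<chi> i. if i \<in> B then a $ i else b $ i)"

lemma restrict_vec_simps:
  "restrict_vec I (a + b) = restrict_vec I a + restrict_vec I b"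
  "restrict_vec I (a - b) = restrict_vec I a - restrict_vec I b"
  "restrict_vec I (restrict_vec J a) = restrict_vec (I \<inter> J) a"
  "restrict_vec B (mix_vec B a b) = restrict_vec B a"
  "restrict_vec (- B) (mix_vec B a b) = restrict_vec (- B) b"
  "restrict_vec B a + restrict_vec (- B) a = a"
  "restrict_vec B a + restrict_vec (- B) b = mix_vec B a b"
  by (auto simp: restrict_vec_def mix_vec_def vec_eq_iff)

lemma block_mult_vec: "block A I J *v y = restrict_vec I (A *v restrict_vec J y)"
  for A :: "real^'n^'n"
  by (auto simp: vec_eq_iff block_def restrict_vec_def matrix_vector_mult_def intro!: sum.cong)

lemma block_mat_1_mult_vec: "block (mat 1) B B *v y = restrict_vec B y"
  for y :: "real^'n"
  by (simp add: block_mult_vec restrict_vec_simps)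

lemma matrix_eqI_mult_vec:
  fixes A C :: "real^'n^'m"
  assumes "\<And>y. A *v y = C *v y"
  shows "A = C"
  using assms by (simp add: matrix_eq)

text \<open>Completing the block by the identity on the complement of \<open>B\<close> gives an invertible matrix \<open>P\<close> that
  commutes with the projection \<open>E\<close> onto the coordinates in \<open>B\<close>. Cutting its inverse down to \<open>B\<close> yields
  the inverse of the block.\<close>

lemma block_inv_eqs:
  fixes M :: "real^'n^'n"
  assumes nonsing: "\<And>u. (\<And>i. i \<notin> B \<Longrightarrow> u $ i = 0) \<Longrightarrow> (\<And>i. i \<in> B \<Longrightarrow> (M *v u) $ i = 0) \<Longrightarrow> u = 0"
  shows "block (block_inv M B) B B = block_inv M B"
    and "block_inv M B ** block M B B = block (mat 1) B B"
proof -
  define E :: "real^'n^'n" where "E = block (mat 1) B B"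
  have E: "E *v y = restrict_vec B y" for y by (simp add: E_def block_mat_1_mult_vec)
  have EE: "E ** E = E"
    by (rule matrix_eqI_mult_vec) (simp add: matrix_vector_mul_assoc[symmetric] E restrict_vec_simps)
  have blk: "block A B B = E ** A ** E" for A :: "real^'n^'n"
    by (rule matrix_eqI_mult_vec) (simp add: matrix_vector_mul_assoc[symmetric] E block_mult_vec)
  define P where "P = E ** M ** E + (mat 1 - E)"
  have "u = 0" if u: "P *v u = 0" for u
  proof -
    have Pu: "(P *v u) $ i = (if i \<in> B then (M *v restrict_vec B u) $ i else u $ i)" for i
      by (simp add: P_def matrix_vector_mult_add_rdistrib matrix_vector_mult_diff_rdistrib
          matrix_vector_mul_assoc[symmetric] E restrict_vec_def)
    have out: "u $ i = 0" if "i \<notin> B" for i using Pu[of i] u that by simp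
    hence "restrict_vec B u = u" by (auto simp: restrict_vec_def vec_eq_iff)
    hence "(M *v u) $ i = 0" if "i \<in> B" for i using Pu[of i] u that by simp
    with out show "u = 0" by (rule nonsing)
  qed
  then obtain Q where QP: "Q ** P = mat 1" using matrix_left_invertible_ker[of P] by blast
  hence PQ: "P ** Q = mat 1" by (simp add: matrix_left_right_inverse)
  have EP: "E ** P = block M B B" and PE: "P ** E = block M B B"
    unfolding P_def
    by (rule matrix_eqI_mult_vec, simp add: matrix_vector_mul_assoc[symmetric] E block_mult_vec
        matrix_vector_mult_add_rdistrib matrix_vector_mult_diff_rdistrib restrict_vec_simps)+
  have QE: "Q ** E = E ** Q"
  proof -
    have "Q ** (E ** P) ** Q = Q ** (P ** E) ** Q" by (simp only: EP PE)
    hence "Q ** E ** (P ** Q) = (Q ** P) ** E ** Q" by (simp only: matrix_mul_assoc)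
    thus ?thesis by (simp add: QP PQ)
  qed
  define G where "G = Q ** E"
  have GE: "G ** E = G" unfolding G_def matrix_mul_assoc[symmetric] EE ..
  have EG: "E ** G = G" unfolding G_def QE matrix_mul_assoc EE ..
  have G1: "block G B B = G" unfolding blk EG GE ..
  have G2: "block M B B ** G = E"
    unfolding PE[symmetric] matrix_mul_assoc[symmetric] EG unfolding G_def matrix_mul_assoc PQ by simp
  have G3: "G ** block M B B = E"
    unfolding EP[symmetric] matrix_mul_assoc GE unfolding G_def QE
    unfolding matrix_mul_assoc[symmetric] QP by simp
  have unique: "H = G" if "block H B B = H" "H ** block M B B = E" for H
  proof -
    have "H ** E = H"
      using that(1) unfolding blk by (metis EE matrix_mul_assoc)
    hence "H = H ** block M B B ** G" unfolding matrix_mul_assoc[symmetric] G2 by simp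
    also have "\<dots> = G" unfolding that(2) by (rule EG)
    finally show ?thesis .
  qed
  have "block_inv M B = G"
    unfolding block_inv_def E_def[symmetric]
    by (rule the_equality, intro conjI G1 G2 G3) (elim conjE, rule unique)
  thus "block (block_inv M B) B B = block_inv M B"
    "block_inv M B ** block M B B = block (mat 1) B B"
    using G1 G3 by (simp_all add: E_def)
qed

text \<open>\<open>M_hat\<close> is the principal pivot transform: solving \<open>w = M u\<close> for the \<open>B\<close>-part of \<open>u\<close>
  exchanges the \<open>B\<close>-parts of \<open>u\<close> and \<open>w\<close>.\<close>

lemma M_hat_exchanges_blocks:
  fixes M :: "real^'n^'n"
  assumes nonsing: "\<And>u. (\<And>i. i \<notin> B \<Longrightarrow> u $ i = 0) \<Longrightarrow> (\<And>i. i \<in> B \<Longrightarrow> (M *v u) $ i = 0) \<Longrightarrow> u = 0"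
  shows "M_hat M B (- B) *v mix_vec B (M *v u) u = mix_vec B u (M *v u)"
proof -
  define G where "G = block_inv M B"
  let ?b = "restrict_vec B" and ?n = "restrict_vec (- B)"
  have G: "G *v y = ?b (G *v ?b y)" for y
    unfolding G_def using block_inv_eqs(1)[OF nonsing] by (metis block_mult_vec)
  have G_out: "?b (G *v y) = G *v y" for y
    by (subst (1 2) G) (simp add: restrict_vec_simps)
  have G_in: "G *v y = G *v ?b y" for y
    by (subst (1 2) G) (simp add: restrict_vec_simps)
  have G_inv: "G *v ?b (M *v ?b y) = ?b y" for y
    using block_inv_eqs(2)[OF nonsing]
    by (metis G_def block_mult_vec block_mat_1_mult_vec matrix_vector_mul_assoc)
  have "?b (M *v u) = ?b (M *v ?b u) + ?b (M *v ?n u)"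
    by (metis matrix_vector_right_distrib restrict_vec_simps(1,6))
  hence Gw: "G *v ?b (M *v u) = ?b u + G *v ?b (M *v ?n u)"
    by (simp add: matrix_vector_right_distrib G_inv)
  have Mu: "?n (M *v ?b u) + ?n (M *v ?n u) = ?n (M *v u)"
    by (metis matrix_vector_right_distrib restrict_vec_simps(1,6))
  have neg: "(- A) *v y = - (A *v y)" for A :: "real^'n^'n" and y
    using matrix_vector_mult_diff_rdistrib[of 0 A y] by simp
  have "M_hat M B (- B) *v mix_vec B (M *v u) u
      = G *v ?b (M *v u) - G *v ?b (M *v ?n u) + ?n (M *v (G *v ?b (M *v u)))
        + (?n (M *v ?n u) - ?n (M *v (G *v ?b (M *v ?n u))))"
    unfolding M_hat_def G_def[symmetric]
    by (simp add: matrix_vector_mult_add_rdistrib matrix_vector_mult_diff_rdistrib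
        neg matrix_vector_mul_assoc[symmetric] block_mult_vec
        restrict_vec_simps G_out G_in[of "mix_vec B _ _"])
  also have "\<dots> = ?b u + ?n (M *v u)"
    unfolding Gw by (simp add: matrix_vector_right_distrib restrict_vec_simps(1) Mu[symmetric])
  finally show ?thesis by (simp add: restrict_vec_simps)
qed

lemma abs_mult_vec_le_row_sum_norm:
  fixes A :: "real^'n^'m"
  assumes "\<And>j. \<bar>y $ j\<bar> \<le> T"
  shows "\<bar>(A *v y) $ i\<bar> \<le> row_sum_norm A * T"
proof -
  have T: "0 \<le> T" using assms[of undefined] by linarith
  have "\<bar>(A *v y) $ i\<bar> \<le> (\<Sum>j\<in>UNIV. \<bar>A $ i $ j * y $ j\<bar>)"
    by (simp add: matrix_vector_mult_def sum_abs)
  also have "\<dots> \<le> (\<Sum>j\<in>UNIV. \<bar>A $ i $ j\<bar> * T)"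
    by (intro sum_mono) (simp add: abs_mult mult_left_mono assms)
  also have "\<dots> = (\<Sum>j\<in>UNIV. \<bar>A $ i $ j\<bar>) * T" by (simp add: sum_distrib_right)
  also have "\<dots> \<le> row_sum_norm A * T"
    unfolding row_sum_norm_def using T by (intro mult_right_mono Max_ge) auto
  finally show ?thesis .
qed

lemma row_sum_norm_nonneg: "0 \<le> row_sum_norm A"
  using abs_mult_vec_le_row_sum_norm[of 0 1 A] by simp

section \<open>Directions close to the solution\<close>

text \<open>After the pivot, \<open>b\<close> collects the variables that are positive at the solution (with value \<open>bs\<close>) and
  \<open>t\<close> those that vanish there. The bounds \<open>\<tau> \<le> y / \<sigma>\<close> on the sum of \<open>t\<close> and \<open>b \<ge> 3 \<sigma> / 4\<close> make
  \<open>b dt\<close> the dominant term of the linear system, because \<open>t db\<close> is at most \<open>\<kappa> \<tau> \<le> \<sigma> / 4\<close> times the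
  largest entry \<open>T\<close> of \<open>dt\<close>. Read at the largest entry, the system bounds \<open>T\<close> by \<open>A\<close>; summed over all
  coordinates, it bounds the sum of \<open>\<bar>dt\<bar>\<close> by \<open>S\<close> without any factor of the dimension.\<close>

lemma pivoted_direction_products:
  fixes H :: "real^'n^'n" and b t bs db dt a :: "real^'n"
  assumes b: "b - bs = H *v t" and db: "db = H *v dt"
    and t: "\<And>i. t $ i > 0" and bs: "\<And>i. bs $ i \<ge> \<sigma>" and \<sigma>: "\<sigma> > 0"
    and gap: "(\<Sum>i\<in>UNIV. t $ i * bs $ i) \<le> y" and small: "4 * row_sum_norm H * y \<le> \<sigma>\<^sup>2"
    and dir: "\<And>i. t $ i * db $ i + b $ i * dt $ i = a $ i"
    and A: "\<And>i. \<bar>a $ i\<bar> \<le> A" and S: "(\<Sum>i\<in>UNIV. \<bar>a $ i\<bar>) \<le> S" and AS: "A \<le> S"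
  shows "\<sigma>\<^sup>2 * (\<Sum>i\<in>UNIV. \<bar>db $ i * dt $ i\<bar>) \<le> 4 * row_sum_norm H * A * S"
proof -
  define \<kappa> where "\<kappa> = row_sum_norm H"
  have \<kappa>: "0 \<le> \<kappa>" by (simp add: \<kappa>_def row_sum_norm_nonneg)
  have A0: "0 \<le> A" using A[of undefined] by linarith
  have "(\<Sum>i\<in>UNIV. t $ i * \<sigma>) \<le> (\<Sum>i\<in>UNIV. t $ i * bs $ i)"
    using t bs by (intro sum_mono mult_left_mono) (auto simp: less_imp_le)
  hence sumt: "(\<Sum>i\<in>UNIV. t $ i) * \<sigma> \<le> y" using gap by (simp add: sum_distrib_right)
  have tle: "t $ i \<le> (\<Sum>i\<in>UNIV. t $ i)" for i
    using t by (intro member_le_sum) (auto simp: less_imp_le)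
  define \<tau> where "\<tau> = (\<Sum>i\<in>UNIV. t $ i)"
  have \<tau>0: "0 \<le> \<tau>" unfolding \<tau>_def using t by (simp add: sum_nonneg less_imp_le)
  have \<kappa>\<tau>: "\<kappa> * \<tau> \<le> \<sigma> / 4"
  proof -
    have "4 * (\<kappa> * \<tau>) * \<sigma> \<le> 4 * \<kappa> * y"
      using mult_left_mono[OF sumt, of "4 * \<kappa>"] \<kappa> by (simp add: \<tau>_def mult.assoc)
    also have "\<dots> \<le> \<sigma> * \<sigma>" using small by (simp add: \<kappa>_def power2_eq_square)
    finally have "4 * (\<kappa> * \<tau>) \<le> \<sigma>" using \<sigma> by simp
    thus ?thesis by simp
  qed
  have bge: "b $ i \<ge> 3/4 * \<sigma>" for i
  proof -
    have "\<bar>(H *v t) $ i\<bar> \<le> \<kappa> * \<tau>"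
      unfolding \<kappa>_def \<tau>_def using t tle
      by (intro abs_mult_vec_le_row_sum_norm) (simp add: abs_of_pos)
    moreover have "b $ i = bs $ i + (H *v t) $ i" using b by (simp add: vec_eq_iff algebra_simps)
    ultimately show ?thesis using bs[of i] \<kappa>\<tau> by linarith
  qed
  define T where "T = Max (range (\<lambda>i. \<bar>dt $ i\<bar>))"
  have dtT: "\<bar>dt $ i\<bar> \<le> T" for i unfolding T_def by (rule Max_ge) auto
  have "T \<in> range (\<lambda>i. \<bar>dt $ i\<bar>)" unfolding T_def by (rule Max_in) auto
  then obtain k where k: "\<bar>dt $ k\<bar> = T" by auto
  have T0: "0 \<le> T" using k by auto
  have dbT: "\<bar>db $ i\<bar> \<le> \<kappa> * T" for i
    unfolding \<kappa>_def db by (rule abs_mult_vec_le_row_sum_norm) (rule dtT)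
  have step: "3/4 * \<sigma> * \<bar>dt $ i\<bar> \<le> \<bar>a $ i\<bar> + t $ i * (\<kappa> * T)" for i
  proof -
    have "3/4 * \<sigma> * \<bar>dt $ i\<bar> \<le> b $ i * \<bar>dt $ i\<bar>" by (rule mult_right_mono[OF bge]) simp
    also have "\<dots> = \<bar>b $ i * dt $ i\<bar>" using bge[of i] \<sigma> by (simp add: abs_mult)
    also have "b $ i * dt $ i = a $ i - t $ i * db $ i" using dir[of i] by simp
    also have "\<bar>a $ i - t $ i * db $ i\<bar> \<le> \<bar>a $ i\<bar> + t $ i * \<bar>db $ i\<bar>"
      using abs_triangle_ineq4[of "a $ i" "t $ i * db $ i"] t[of i] by (simp add: abs_mult)
    also have "t $ i * \<bar>db $ i\<bar> \<le> t $ i * (\<kappa> * T)"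
      using t[of i] dbT[of i] by (intro mult_left_mono) auto
    finally show ?thesis by simp
  qed
  have \<tau>T: "\<tau> * (\<kappa> * T) \<le> \<sigma> / 4 * T"
    using mult_right_mono[OF \<kappa>\<tau> T0] by (simp add: mult_ac)
  have "t $ k * (\<kappa> * T) \<le> \<tau> * (\<kappa> * T)"
    using tle[of k] \<kappa> T0 by (intro mult_right_mono) (auto simp: \<tau>_def)
  hence \<sigma>T: "\<sigma> * T \<le> 2 * A" using step[of k] A[of k] \<tau>T unfolding k by linarith
  have "3/4 * \<sigma> * (\<Sum>i\<in>UNIV. \<bar>dt $ i\<bar>) \<le> (\<Sum>i\<in>UNIV. \<bar>a $ i\<bar> + t $ i * (\<kappa> * T))"
    unfolding sum_distrib_left by (rule sum_mono) (rule step)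
  also have "\<dots> \<le> S + \<tau> * (\<kappa> * T)"
    using S by (simp add: sum.distrib \<tau>_def sum_distrib_right)
  also have "\<dots> \<le> 3/2 * S" using \<tau>T \<sigma>T AS by linarith
  finally have \<sigma>sum: "\<sigma> * (\<Sum>i\<in>UNIV. \<bar>dt $ i\<bar>) \<le> 2 * S" by linarith
  have "(\<Sum>i\<in>UNIV. \<bar>db $ i * dt $ i\<bar>) \<le> (\<Sum>i\<in>UNIV. \<kappa> * T * \<bar>dt $ i\<bar>)"
    unfolding abs_mult by (intro sum_mono mult_right_mono dbT) simp
  hence "\<sigma>\<^sup>2 * (\<Sum>i\<in>UNIV. \<bar>db $ i * dt $ i\<bar>) \<le> \<sigma>\<^sup>2 * (\<kappa> * T * (\<Sum>i\<in>UNIV. \<bar>dt $ i\<bar>))"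
    by (intro mult_left_mono) (simp_all add: sum_distrib_left)
  also have "\<dots> = \<kappa> * ((\<sigma> * T) * (\<sigma> * (\<Sum>i\<in>UNIV. \<bar>dt $ i\<bar>)))"
    by (simp add: power2_eq_square mult_ac)
  also have "\<dots> \<le> \<kappa> * ((2 * A) * (2 * S))"
    using \<kappa> A0 \<sigma> by (intro mult_left_mono mult_mono \<sigma>T \<sigma>sum) (auto intro: sum_nonneg mult_nonneg_nonneg)
  finally show ?thesis by (simp add: \<kappa>_def mult_ac)
qed

text \<open>A kernel vector of the block \<open>M\<^sub>B\<^sub>B\<close> is a direction along which complementarity and the equation
  persist. Strict complementarity leaves room for a small step, which would give a second solution.\<close>

lemma unique_strict_solution_nonsingular:
  fixes M :: "real^'n^'n"
  assumes sol: "lcp_solutions M q = {(xs, ss)}" and strict: "\<And>i. xs $ i + ss $ i > 0"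
    and out: "\<And>i. i \<notin> {i. xs $ i > 0} \<Longrightarrow> u $ i = 0"
    and ker: "\<And>i. i \<in> {i. xs $ i > 0} \<Longrightarrow> (M *v u) $ i = 0"
  shows "u = 0"
proof -
  have "(xs, ss) \<in> lcp_solutions M q" by (simp add: sol)
  hence nonneg: "xs $ i \<ge> 0" "ss $ i \<ge> 0" and feas: "- (M *v xs) + ss = q"
    and compl: "xs $ i * ss $ i = 0" for i
    by (auto simp: lcp_solutions_def lcp_feasible_def vec_eq_iff)
  define \<mu> where "\<mu> = Min (range (\<lambda>i. xs $ i + ss $ i))"
  have \<mu>: "0 < \<mu>" "\<mu> \<le> xs $ i + ss $ i" for i
    using strict by (auto simp: \<mu>_def)
  define e where "e = \<mu> / (1 + norm u + norm (M *v u))"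
  have den: "0 < 1 + norm u + norm (M *v u)" by (simp add: add_pos_nonneg)
  have e: "0 < e" using \<mu>(1) den by (simp add: e_def)
  have e1: "e * (1 + norm u + norm (M *v u)) = \<mu>" using den by (simp add: e_def)
  have eu: "e * \<bar>u $ i\<bar> \<le> \<mu>" and ew: "e * \<bar>(M *v u) $ i\<bar> \<le> \<mu>" for i
    using component_le_norm_cart[of u i] component_le_norm_cart[of "M *v u" i] e
    unfolding e1[symmetric] by (intro mult_left_mono; simp add: add_increasing add_increasing2)+
  let ?x = "xs + e *\<^sub>R u" and ?s = "ss + e *\<^sub>R (M *v u)"
  have coord: "?x $ i \<ge> 0 \<and> ?s $ i \<ge> 0 \<and> ?x $ i * ?s $ i = 0" for i
  proof (cases "xs $ i > 0")
    case True
    hence "ss $ i = 0" "(M *v u) $ i = 0" using compl[of i] ker by auto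
    moreover have "- \<mu> \<le> e * u $ i" using eu[of i] e by (simp add: abs_le_iff abs_mult_pos')
    ultimately show ?thesis using \<mu>(2)[of i] by simp
  next
    case False
    hence "xs $ i = 0" "u $ i = 0" using nonneg(1)[of i] out by auto
    moreover have "- \<mu> \<le> e * (M *v u) $ i" using ew[of i] e by (simp add: abs_le_iff abs_mult_pos')
    ultimately show ?thesis using \<mu>(2)[of i] by simp
  qed
  have "- (M *v ?x) + ?s = q"
    using feas by (simp add: matrix_vector_right_distrib matrix_vector_mult_scaleR)
  with coord have "(?x, ?s) \<in> lcp_solutions M q"
    by (simp add: lcp_solutions_def lcp_feasible_def vec_eq_iff)
  hence "e *\<^sub>R u = 0" by (simp add: sol)
  thus ?thesis using e by simp
qed

text \<open>The pivot applies both to the direction and to the difference from the solution. Monotonicity,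
  \<open>(x - xs) \<bullet> (s - ss) \<ge> 0\<close>, turns the duality gap \<open>x \<bullet> s\<close> into a bound on the vanishing
  variables.\<close>

lemma direction_products_near_solution:
  fixes M :: "real^'n^'n" and x s :: "real^'n"
  assumes psd: "psd M" and sol: "lcp_solutions M q = {(xs, ss)}"
    and strict: "\<And>i. xs $ i + ss $ i > 0"
    and int: "(x, s) \<in> lcp_interior M q" and gap: "x \<bullet> s \<le> y"
    and small: "4 * lcp_kappa M xs ss * y \<le> (lcp_sigma xs ss)\<^sup>2"
    and dir: "is_direction M x s a dx ds"
    and A: "\<And>i. \<bar>a $ i\<bar> \<le> A" and S: "(\<Sum>i\<in>UNIV. \<bar>a $ i\<bar>) \<le> S" and AS: "A \<le> S"
  shows "lcp_sigma xs ss > 0"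
    and "(lcp_sigma xs ss)\<^sup>2 * (\<Sum>i\<in>UNIV. \<bar>dx $ i * ds $ i\<bar>) \<le> 4 * lcp_kappa M xs ss * A * S"
proof -
  define B where "B = {i. xs $ i > 0}"
  define \<sigma> where "\<sigma> = lcp_sigma xs ss"
  have "(xs, ss) \<in> lcp_solutions M q" by (simp add: sol)
  hence nonneg: "xs $ i \<ge> 0" "ss $ i \<ge> 0" and feas: "- (M *v xs) + ss = q"
    and compl: "xs $ i * ss $ i = 0" for i
    by (auto simp: lcp_solutions_def lcp_feasible_def vec_eq_iff)
  have on: "ss $ i = 0" if "i \<in> B" for i using that compl[of i] by (simp add: B_def)
  have off: "xs $ i = 0" if "i \<notin> B" for i using that nonneg(1)[of i] by (simp add: B_def)
  have N: "{i. ss $ i > 0} = - B"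
  proof (rule set_eqI)
    fix i show "i \<in> {i. ss $ i > 0} \<longleftrightarrow> i \<in> - B"
      using on[of i] off[of i] strict[of i] by (cases "i \<in> B") auto
  qed
  let ?H = "M_hat M B (- B)"
  have kappa: "lcp_kappa M xs ss = row_sum_norm ?H"
    by (simp add: lcp_kappa_def N B_def[symmetric])
  let ?F = "(($) xs) ` B \<union> (($) ss) ` (- B)"
  have sigma: "\<sigma> = Min ?F" by (simp add: \<sigma>_def lcp_sigma_def N B_def[symmetric])
  have "?F \<noteq> {}" by blast
  moreover have "\<forall>c\<in>?F. c > 0" using N by (auto simp: B_def)
  ultimately show \<sigma>: "lcp_sigma xs ss > 0" using sigma by (simp add: \<sigma>_def)
  have \<sigma>le: "mix_vec B xs ss $ i \<ge> \<sigma>" for i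
    unfolding sigma by (rule Min_le) (auto simp: mix_vec_def)
  have pos: "x $ i > 0" "s $ i > 0" and xsq: "- (M *v x) + s = q" for i
    using int by (auto simp: lcp_interior_def lcp_feasible_def)
  have pivot: "mix_vec B u w = ?H *v mix_vec B w u" if "w = M *v u" for u w
    unfolding that
    by (rule M_hat_exchanges_blocks[symmetric], rule unique_strict_solution_nonsingular[OF sol strict])
      (auto simp: B_def)
  have Mdiff: "s - ss = M *v (x - xs)"
    using feas xsq by (simp add: matrix_vector_mult_diff_distrib algebra_simps)
  have "mix_vec B x s - mix_vec B xs ss = mix_vec B (x - xs) (s - ss)"
    by (auto simp: mix_vec_def vec_eq_iff)
  also have "\<dots> = ?H *v mix_vec B (s - ss) (x - xs)" by (rule pivot[OF Mdiff])
  also have "mix_vec B (s - ss) (x - xs) = mix_vec B s x"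
    using on off by (auto simp: mix_vec_def vec_eq_iff)
  finally have b: "mix_vec B x s - mix_vec B xs ss = ?H *v mix_vec B s x" .
  have "0 \<le> (x - xs) \<bullet> (s - ss)" using psd by (simp add: Mdiff psd_def)
  moreover have "xs \<bullet> ss = 0" by (simp add: inner_vec_def compl)
  ultimately have "xs \<bullet> s + x \<bullet> ss \<le> x \<bullet> s"
    by (simp add: inner_diff_left inner_diff_right)
  moreover have "(\<Sum>i\<in>UNIV. mix_vec B s x $ i * mix_vec B xs ss $ i) = xs \<bullet> s + x \<bullet> ss"
    unfolding inner_vec_def sum.distrib[symmetric]
    by (rule sum.cong) (auto simp: mix_vec_def on off)
  ultimately have t: "(\<Sum>i\<in>UNIV. mix_vec B s x $ i * mix_vec B xs ss $ i) \<le> y"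
    using gap by linarith
  have "ds = M *v dx" using dir by (simp add: is_direction_def)
  hence d: "mix_vec B dx ds = ?H *v mix_vec B ds dx" by (rule pivot)
  have "s $ i * dx $ i + x $ i * ds $ i = a $ i" for i
    using dir by (auto simp: is_direction_def vec_eq_iff)
  hence lin: "mix_vec B s x $ i * mix_vec B dx ds $ i + mix_vec B x s $ i * mix_vec B ds dx $ i = a $ i"
    for i by (auto simp: mix_vec_def add.commute)
  have "\<sigma>\<^sup>2 * (\<Sum>i\<in>UNIV. \<bar>mix_vec B dx ds $ i * mix_vec B ds dx $ i\<bar>) \<le> 4 * row_sum_norm ?H * A * S"
  proof (rule pivoted_direction_products[OF b d _ \<sigma>le _ t _ lin A S AS])
    show "mix_vec B s x $ i > 0" for i by (simp add: mix_vec_def pos)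
    show "\<sigma> > 0" using \<sigma> by (simp add: \<sigma>_def)
    show "4 * row_sum_norm ?H * y \<le> \<sigma>\<^sup>2" using small by (simp add: kappa \<sigma>_def)
  qed
  moreover have "mix_vec B dx ds $ i * mix_vec B ds dx $ i = dx $ i * ds $ i" for i
    by (simp add: mix_vec_def mult.commute)
  ultimately show "(lcp_sigma xs ss)\<^sup>2 * (\<Sum>i\<in>UNIV. \<bar>dx $ i * ds $ i\<bar>) \<le> 4 * lcp_kappa M xs ss * A * S"
    by (simp add: kappa \<sigma>_def)
qed

section \<open>Contraction of the target\<close>

text \<open>For the auto-corrector one may take \<open>A = 2 y\<close> and \<open>S = 3 y\<close>, as \<open>v\<^sup>2 < x s\<close> and \<open>x \<bullet> s < y\<close>. The
  constant is \<open>10 = 1 + 3/2 * 6\<close>, where \<open>4 A S = 24 y\<^sup>2\<close> is divided by the 4 in the bound on \<open>\<kappa> V\<close>.\<close>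

lemma norm_predictor_err_near_solution:
  fixes M :: "real^'n^'n" and x s v :: "real^'n"
  assumes psd: "psd M" and sol: "lcp_solutions M q = {(xs, ss)}"
    and strict: "\<And>i. xs $ i + ss $ i > 0"
    and z: "(x, s, (y, v)) \<in> z_interior M q"
    and V: "0 < V" "y \<le> V" "V * (norm v)\<^sup>2 \<le> y\<^sup>2"
    and small: "4 * lcp_kappa M xs ss * V \<le> (lcp_sigma xs ss)\<^sup>2"
    and dir: "is_direction M x s (rhs_autocorrector (x, s, (y, v))) dx ds"
  shows "V * norm (predictor_err v dx ds) \<le> 10 * y\<^sup>2"
proof -
  let ?g = "(norm v)\<^sup>2" and ?m = "real CARD('n) + 1"
  define a where "a = rhs_autocorrector (x, s, (y, v))"
  define \<kappa> \<sigma> where "\<kappa> = lcp_kappa M xs ss" and "\<sigma> = lcp_sigma xs ss"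
  define c where "c j = x $ j * s $ j" for j
  have int: "(x, s) \<in> lcp_interior M q" and gy: "?g < y" and vc: "(v $ j)\<^sup>2 < c j"
    and xsy: "(\<Sum>j\<in>UNIV. c j) < y" for j
    using z by (auto simp: z_interior_def w_interior_def c_def inner_vec_def)
  have \<kappa>: "0 \<le> \<kappa>" by (simp add: \<kappa>_def lcp_kappa_def row_sum_norm_nonneg)
  have y: "0 < y" using gy zero_le_power2[of "norm v"] by linarith
  have cpos: "0 < c j" for j using vc[of j] zero_le_power2[of "v $ j"] by linarith
  have cj: "c j \<le> (\<Sum>j\<in>UNIV. c j)" for j
    using cpos by (intro member_le_sum) (auto simp: less_imp_le)
  have gm: "0 \<le> ?g / ?m" "?g / ?m \<le> ?g" "real CARD('n) * (?g / ?m) \<le> ?g"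
    by (auto simp: divide_le_eq field_simps)
  have a_abs: "\<bar>a $ j\<bar> \<le> ?g / ?m + (v $ j)\<^sup>2 + c j" "\<bar>a $ j\<bar> \<le> 2 * y" for j
  proof -
    have aj: "a $ j = ?g / ?m - (v $ j)\<^sup>2 - c j" by (simp add: a_def c_def)
    show "\<bar>a $ j\<bar> \<le> ?g / ?m + (v $ j)\<^sup>2 + c j" "\<bar>a $ j\<bar> \<le> 2 * y"
      unfolding aj using gm(1,2) gy vc[of j] cj[of j] xsy cpos[of j] zero_le_power2[of "v $ j"]
      by linarith+
  qed
  have "(\<Sum>j\<in>UNIV. \<bar>a $ j\<bar>) \<le> (\<Sum>j\<in>UNIV. ?g / ?m + (v $ j)\<^sup>2 + c j)"
    by (rule sum_mono) (rule a_abs)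
  also have "\<dots> = real CARD('n) * (?g / ?m) + ?g + (\<Sum>j\<in>UNIV. c j)"
    by (simp add: sum.distrib norm_vec_sq)
  also have "\<dots> \<le> 3 * y" using gm(3) gy xsy by linarith
  finally have a_sum: "(\<Sum>j\<in>UNIV. \<bar>a $ j\<bar>) \<le> 3 * y" .
  have "4 * \<kappa> * y \<le> 4 * \<kappa> * V" using V \<kappa> by (intro mult_left_mono) auto
  hence small': "4 * \<kappa> * y \<le> \<sigma>\<^sup>2" using small by (simp add: \<kappa>_def \<sigma>_def)
  define D where "D = (\<Sum>j\<in>UNIV. \<bar>dx $ j * ds $ j\<bar>)"
  have xs_y: "x \<bullet> s \<le> y" using xsy by (simp add: c_def inner_vec_def)
  note near = direction_products_near_solution[OF psd sol strict int xs_y small'[unfolded \<kappa>_def \<sigma>_def]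
      dir[folded a_def] a_abs(2) a_sum]
  have \<sigma>: "0 < \<sigma>" using near(1) y by (simp add: \<sigma>_def)
  have "\<sigma>\<^sup>2 * D \<le> 4 * \<kappa> * (2 * y) * (3 * y)"
    using near(2) y by (simp add: \<sigma>_def \<kappa>_def D_def)
  hence "V * (\<sigma>\<^sup>2 * D) \<le> V * (4 * \<kappa> * (2 * y) * (3 * y))" using V by (intro mult_left_mono) auto
  also have "\<dots> = 4 * \<kappa> * V * (6 * y\<^sup>2)" by (simp add: power2_eq_square)
  also have "\<dots> \<le> \<sigma>\<^sup>2 * (6 * y\<^sup>2)"
    using small by (intro mult_right_mono) (auto simp: \<kappa>_def \<sigma>_def)
  finally have "\<sigma>\<^sup>2 * (V * D) \<le> \<sigma>\<^sup>2 * (6 * y\<^sup>2)" by (simp add: mult_ac)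
  hence VD: "V * D \<le> 6 * y\<^sup>2" using \<sigma> by simp
  have "V * norm (predictor_err v dx ds) \<le> V * (?g + 3/2 * D)"
    using V by (intro mult_left_mono norm_predictor_err_le) (auto simp: D_def)
  thus ?thesis using V(3) VD by (simp add: distrib_left)
qed

text \<open>It suffices to exhibit an admissible step length. The value of \<open>\<theta>\<close> in the conclusion makes
  \<open>\<theta> \<rho> \<beta> / (1 - \<beta>)\<close> at least \<open>12 y\<^sup>2 / V\<close>, which exceeds the error; if that value is 1 or more, there is
  nothing to prove. The strict bound \<open>\<theta> < 1\<close> is what makes the target smaller than \<open>V\<close> after
  one iteration, so that \<open>V - y\<close> is positive from then on.\<close>

lemma predictor_step_contraction:
  fixes M :: "real^'n^'n" and x s v :: "real^'n"
  assumes psd: "psd M" and sol: "lcp_solutions M q = {(xs, ss)}"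
    and strict: "\<And>i. xs $ i + ss $ i > 0"
    and \<beta>: "0 < \<beta>" "\<beta> < 1/3"
    and z: "(x, s, (y, v)) \<in> nbhd_delta M q \<beta>"
    and V: "0 < V" "y \<le> V" "V * (norm v)\<^sup>2 \<le> y\<^sup>2"
    and small: "4 * lcp_kappa M xs ss * V \<le> (lcp_sigma xs ss)\<^sup>2"
    and step: "predictor_step M q (omega_star (2 * \<beta> / (1 - \<beta>))) (x, s, (y, v)) z'"
  obtains \<theta> where "0 < \<theta>" "\<theta> < 1" "snd (snd z') = \<theta> *\<^sub>R (y, v)"
    "y < V \<Longrightarrow> \<theta> \<le> 12 * (1 - \<beta>) * (real CARD('n) + 1) / (\<beta> * (V - y)) * y"
proof -
  let ?z = "(x, s, (y, v))" and ?m = "real CARD('n) + 1"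
  let ?N = "nbhd_Psi M q (omega_star (2 * \<beta> / (1 - \<beta>)))"
  obtain dx ds \<alpha>\<^sub>p where dir: "is_direction M x s (rhs_autocorrector ?z) dx ds"
    and \<alpha>p: "0 \<le> \<alpha>\<^sub>p" "\<alpha>\<^sub>p \<le> 1" "predictor_point ?z dx ds \<alpha>\<^sub>p \<in> ?N"
    and max: "\<And>\<alpha>. 0 \<le> \<alpha> \<Longrightarrow> \<alpha> \<le> 1 \<Longrightarrow> predictor_point ?z dx ds \<alpha> \<in> ?N \<Longrightarrow> \<alpha> \<le> \<alpha>\<^sub>p"
    and z': "z' = predictor_point ?z dx ds \<alpha>\<^sub>p"
    using step unfolding predictor_step_def Let_def by auto
  have int: "?z \<in> z_interior M q" using z by (simp add: nbhd_delta_def)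
  have "(norm v)\<^sup>2 < y" using int by (simp add: z_interior_def w_interior_def)
  hence y: "0 < y" using zero_le_power2[of "norm v"] by linarith
  define E where "E = norm (predictor_err v dx ds)"
  define R where "R = \<beta> / (1 - \<beta>) * rho (y, v)"
  have R: "0 < R" using z_interior_resid_pos[OF int] \<beta> by (simp add: R_def)
  have E0: "0 \<le> E" by (simp add: E_def)
  have VE: "V * E \<le> 10 * y\<^sup>2"
    unfolding E_def by (rule norm_predictor_err_near_solution[OF psd sol strict int V small dir])
  have adm: "\<alpha> \<le> \<alpha>\<^sub>p" if "0 \<le> \<alpha>" "\<alpha> < 1" "\<alpha>\<^sup>2 * E \<le> (1 - \<alpha>) * R" for \<alpha>
    using that by (intro max predictor_point_in_nbhd_Psi[OF z \<beta> dir]) (auto simp: E_def R_def)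
  have "\<alpha>\<^sub>p \<noteq> 1" using \<alpha>p(3) by (auto simp: nbhd_Psi_def z_interior_def w_interior_def)
  hence lt1: "\<alpha>\<^sub>p < 1" using \<alpha>p(2) by simp
  have gt0: "0 < \<alpha>\<^sub>p"
  proof -
    define \<alpha> where "\<alpha> = R / (E + R)"
    have ER: "0 < E + R" using E0 R by simp
    have \<alpha>: "0 < \<alpha>" "\<alpha> \<le> 1" using ER E0 R by (auto simp: \<alpha>_def)
    have eq: "\<alpha> * E = (1 - \<alpha>) * R" using ER by (simp add: \<alpha>_def field_simps)
    \<comment> \<open>Halving keeps the step below 1 also if the error vanishes.\<close>
    have "(\<alpha> / 2)\<^sup>2 * E \<le> \<alpha> * E"
    proof (rule mult_right_mono[OF _ E0])
      have "\<alpha> * \<alpha> \<le> \<alpha> * 1" using \<alpha> by (intro mult_left_mono) auto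
      thus "(\<alpha> / 2)\<^sup>2 \<le> \<alpha>" using \<alpha> by (simp add: power2_eq_square)
    qed
    also have "\<dots> \<le> (1 - \<alpha> / 2) * R" unfolding eq using \<alpha> R by (intro mult_right_mono) auto
    finally have "\<alpha> / 2 \<le> \<alpha>\<^sub>p" using \<alpha> by (intro adm) auto
    thus ?thesis using \<alpha> by linarith
  qed
  show ?thesis
  proof (rule that[of "1 - \<alpha>\<^sub>p"])
    show "0 < 1 - \<alpha>\<^sub>p" "1 - \<alpha>\<^sub>p < 1" using lt1 gt0 by auto
    show "snd (snd z') = (1 - \<alpha>\<^sub>p) *\<^sub>R (y, v)" by (simp add: z')
    assume yV: "y < V"
    define \<theta> where "\<theta> = 12 * (1 - \<beta>) * ?m / (\<beta> * (V - y)) * y"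
    have \<theta>: "0 < \<theta>" using \<beta> yV y by (simp add: \<theta>_def add_nonneg_pos)
    show "1 - \<alpha>\<^sub>p \<le> 12 * (1 - \<beta>) * ?m / (\<beta> * (V - y)) * y"
    proof (cases "\<theta> < 1")
      case True
      have rho: "y * (V - y) \<le> V * (?m * rho (y, v))"
      proof -
        have "?m * rho (y, v) = y - (norm v)\<^sup>2" by (simp add: rho.simps add_nonneg_eq_0_iff)
        moreover have "y * (V - y) \<le> V * (y - (norm v)\<^sup>2)"
          using V(3) by (simp add: algebra_simps power2_eq_square)
        ultimately show ?thesis by simp
      qed
      have "E \<le> \<theta> * R"
      proof -
        have "12 * b * m / (\<beta> * d) * y * (\<beta> / b * r) = 12 * y / d * (m * r)" if "b \<noteq> 0"
          for b d m r :: real using that \<beta> by (simp add: field_simps)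
        hence "\<theta> * R = 12 * y / (V - y) * (?m * rho (y, v))"
          unfolding \<theta>_def R_def by this (use \<beta> in simp)
        hence "V * (\<theta> * R) = 12 * y / (V - y) * (V * (?m * rho (y, v)))" by simp
        also have "\<dots> \<ge> 12 * y / (V - y) * (y * (V - y))"
          using y yV by (intro mult_left_mono rho) auto
        also have "12 * y / (V - y) * (y * (V - y)) = 12 * y\<^sup>2"
          using yV by (simp add: power2_eq_square)
        finally have "V * (\<theta> * R) \<ge> 12 * y\<^sup>2" .
        hence "V * E \<le> V * (\<theta> * R)" using VE zero_le_power2[of y] by linarith
        thus ?thesis using V(1) by simp
      qed
      moreover have "(1 - \<theta>)\<^sup>2 * E \<le> 1 * E"
        using \<theta> True by (intro mult_right_mono E0) (auto simp: power_le_one)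
      ultimately have "1 - \<theta> \<le> \<alpha>\<^sub>p" using \<theta> True by (intro adm) auto
      thus ?thesis by (simp add: \<theta>_def)
    next
      case False
      thus ?thesis using gt0 by (simp add: \<theta>_def)
    qed
  qed
qed

lemma corrector_steps_keep_w:
  assumes "(corrector_step M q \<beta>)\<^sup>*\<^sup>* y z"
  shows "snd (snd z) = snd (snd y)"
  using assms
proof induction
  case (step z z')
  obtain x s w where "z = (x, s, w)" by (metis prod.collapse)
  with step show ?case by (auto simp: corrector_step_def)
qed simp

theorem theorem5p6:
  fixes M :: "real^'n^'n" and q xs ss :: "real^'n"
    and \<epsilon> \<beta> \<tau> :: real and z0 :: "'n zpoint"
    and Z :: "nat \<Rightarrow> 'n zpoint" and K :: nat
  assumes "psd M"
    and "lcp_interior M q \<noteq> {}"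
    and "lcp_solutions M q = {(xs, ss)}"
    and "\<forall>i. xs $ i + ss $ i > 0"
    and "\<epsilon> > 0"
    and "0 < \<beta>" and "\<beta> < 1/3"
    and "\<tau> = omega_star (2 * \<beta> / (1 - \<beta>))"
    and "z0 \<in> nbhd_delta M q \<beta>"
    and "ac_ipa_run M q \<epsilon> \<beta> \<tau> z0 K Z"
    and "lcp_kappa M xs ss \<noteq> 0 \<longrightarrow> v0_coord (Z 0) \<le> (lcp_sigma xs ss)\<^sup>2 / (4 * lcp_kappa M xs ss)"
  shows "\<forall>k. 1 \<le> k \<and> k + 1 \<le> K \<longrightarrow>
    v0_coord (Z (k + 1)) \<le>
      (12 * (1 - \<beta>) * (real CARD('n) + 1) / (\<beta> * (v0_coord (Z 0) - v0_coord (Z k)))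
       + 2 * \<beta> / ((1 - \<beta>) * v0_coord (Z 0) * (real CARD('n) + 1)))
      * (v0_coord (Z k))\<^sup>2"
proof -
  let ?m = "real CARD('n) + 1"
  obtain x0 s0 V u where z0: "z0 = (x0, s0, (V, u))" by (metis prod.collapse)
  have Z0: "Z 0 = z0" and iter: "\<And>k. k < K \<Longrightarrow> outer_iteration M q \<epsilon> \<beta> \<tau> (Z k) (Z (Suc k))"
    using assms(10) by (auto simp: ac_ipa_run_def)
  have uV: "(norm u)\<^sup>2 < V"
    using assms(9) by (auto simp: z0 nbhd_delta_def z_interior_def w_interior_def)
  have V: "0 < V" using uV zero_le_power2[of "norm u"] by linarith
  have small: "4 * lcp_kappa M xs ss * V \<le> (lcp_sigma xs ss)\<^sup>2"
  proof (cases "lcp_kappa M xs ss = 0")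
    case False
    moreover have "0 \<le> lcp_kappa M xs ss" by (simp add: lcp_kappa_def row_sum_norm_nonneg)
    ultimately show ?thesis using assms(11) by (simp add: Z0 z0 field_simps)
  qed simp
  have step: "\<exists>\<theta>. 0 < \<theta> \<and> \<theta> < 1 \<and> snd (snd (Z (Suc k))) = (\<theta> * c) *\<^sub>R (V, u)
      \<and> Z (Suc k) \<in> nbhd_delta M q \<beta>
      \<and> (c < 1 \<longrightarrow> \<theta> \<le> 12 * (1 - \<beta>) * ?m / (\<beta> * (V - c * V)) * (c * V))"
    if k: "k < K" and c: "0 < c" "c \<le> 1" "snd (snd (Z k)) = c *\<^sub>R (V, u)"
      and nb: "Z k \<in> nbhd_delta M q \<beta>" for k c
  proof -
    obtain x s where Zk: "Z k = (x, s, (c * V, c *\<^sub>R u))" using c(3) by (cases "Z k") auto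
    obtain z' where pred: "predictor_step M q \<tau> (Z k) z'"
      and corr: "(corrector_step M q \<beta>)\<^sup>*\<^sup>* z' (Z (Suc k))"
      and nb': "Z (Suc k) \<in> nbhd_delta M q \<beta>"
      using iter[OF k] by (auto simp: outer_iteration_def)
    have "c * V \<le> 1 * V" using c V by (intro mult_right_mono) auto
    hence cV: "c * V \<le> V" by simp
    have "V * (c\<^sup>2 * (norm u)\<^sup>2) \<le> V * (c\<^sup>2 * V)"
      using uV V by (intro mult_left_mono) auto
    hence vv: "V * (norm (c *\<^sub>R u))\<^sup>2 \<le> (c * V)\<^sup>2"
      by (simp add: power_mult_distrib power2_eq_square mult_ac)
    obtain \<theta> where \<theta>: "0 < \<theta>" "\<theta> < 1" "snd (snd z') = \<theta> *\<^sub>R (c * V, c *\<^sub>R u)"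
      "c * V < V \<Longrightarrow> \<theta> \<le> 12 * (1 - \<beta>) * ?m / (\<beta> * (V - c * V)) * (c * V)"
      using predictor_step_contraction[OF assms(1,3) _ assms(6,7) nb[unfolded Zk] V cV vv small
          pred[unfolded Zk assms(8)]] assms(4) by blast
    have "snd (snd (Z (Suc k))) = (\<theta> * c) *\<^sub>R (V, u)"
      using corrector_steps_keep_w[OF corr] \<theta>(3) by simp
    moreover have "c * V < V" if "c < 1" using that V by simp
    ultimately show ?thesis using \<theta> nb' by blast
  qed
  \<comment> \<open>The targets of all iterates are positive multiples of the initial one, strictly smaller after
     the first iteration.\<close>
  have inv: "\<exists>c. 0 < c \<and> c \<le> 1 \<and> (0 < k \<longrightarrow> c < 1) \<and> snd (snd (Z k)) = c *\<^sub>R (V, u)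
      \<and> Z k \<in> nbhd_delta M q \<beta>" if "k \<le> K" for k
    using that
  proof (induction k)
    case 0
    show ?case using assms(9) by (intro exI[of _ 1]) (simp add: Z0 z0)
  next
    case (Suc k)
    then obtain c where c: "0 < c" "c \<le> 1" "snd (snd (Z k)) = c *\<^sub>R (V, u)"
      "Z k \<in> nbhd_delta M q \<beta>" by auto
    then obtain \<theta> where \<theta>: "0 < \<theta>" "\<theta> < 1" "snd (snd (Z (Suc k))) = (\<theta> * c) *\<^sub>R (V, u)"
      "Z (Suc k) \<in> nbhd_delta M q \<beta>" using step[of k c] Suc.prems by auto
    have "\<theta> * c \<le> \<theta> * 1" using c \<theta> by (intro mult_left_mono) auto
    hence "\<theta> * c < 1" using \<theta> by linarith
    thus ?case using c \<theta> by (intro exI[of _ "\<theta> * c"]) auto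
  qed
  have v0: "v0_coord z = c * V" if "snd (snd z) = c *\<^sub>R (V, u)" for z :: "'n zpoint" and c
    using that by (cases z) auto
  show ?thesis
  proof (intro allI impI)
    fix k assume k: "1 \<le> k \<and> k + 1 \<le> K"
    obtain c where c: "0 < c" "c < 1" "snd (snd (Z k)) = c *\<^sub>R (V, u)" "Z k \<in> nbhd_delta M q \<beta>"
      using inv[of k] k by auto
    obtain \<theta> where \<theta>: "snd (snd (Z (Suc k))) = (\<theta> * c) *\<^sub>R (V, u)"
      "\<theta> \<le> 12 * (1 - \<beta>) * ?m / (\<beta> * (V - c * V)) * (c * V)"
      using step[of k c] k c by auto
    define y C where "y = c * V" and "C = 12 * (1 - \<beta>) * ?m / (\<beta> * (V - y))"
    have y: "0 \<le> y" using c V by (simp add: y_def)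
    have "v0_coord (Z (k + 1)) = \<theta> * y" using v0[OF \<theta>(1)] by (simp add: y_def)
    also have "\<dots> \<le> C * y * y" using \<theta>(2) y by (intro mult_right_mono) (simp_all add: y_def C_def)
    also have "\<dots> = C * y\<^sup>2" by (simp add: power2_eq_square)
    also have "\<dots> \<le> (C + 2 * \<beta> / ((1 - \<beta>) * V * ?m)) * y\<^sup>2"
      using assms(6,7) V by (intro mult_right_mono) auto
    finally show "v0_coord (Z (k + 1)) \<le>
      (12 * (1 - \<beta>) * ?m / (\<beta> * (v0_coord (Z 0) - v0_coord (Z k)))
       + 2 * \<beta> / ((1 - \<beta>) * v0_coord (Z 0) * ?m)) * (v0_coord (Z k))\<^sup>2"
      by (simp add: v0[OF c(3)] Z0 z0 y_def[symmetric] C_def)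
  qed
qed

end
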